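(* Let $(W,S)$ be a Coxeter system. For $U\subseteq\mathcal{F}(W,S)$, denote by $C(W,U)$ the subgroup of $C(W,S)$ generated by $\{c_X\mid X\in U\}$. (1) The group $C(W,S)$ is abelian if and only if $W$ is abelian. (2) When $W$ is not abelian, there exist $X,Y\in\mathcal{F}(W,S)$ and a subgroup $G$ of $C(W,S)$ such that (a) $C(W,\{X,Y\})$ is isomorphic to the free product $\mathbb{Z}_2*\mathbb{Z}_2$ (where $\mathbb{Z}_2=\mathbb{Z}/2\mathbb{Z}$); (b) $C(W,S)=G\rtimes C(W,\{X,Y\})$ (internal semidirect product with $G$ normal); (c) the lower central series of $C(W,S)$ does not stabilize.
   Context: A Coxeter matrix on a finite set $S$ is a symmetric matrix $(m_{s,t})_{s,t\in S}$ with diagonal entries $1$ and off-diagonal entries in $\mathbb{N}_{\ge 2}\cup\{\infty\}$. The associated Coxeter group is $W=\langle S\mid s^2=1;\ Prod(t,s,m_{s,t})=Prod(s,t,m_{s,t})$ for $s\ne t$ in $S$ with $m_{s,t}\neq\infty\rangle$, where $Prod(s,t,m)$ is the word $sts\cdots$ with $m$ letters; $(W,S)$ is the associated Coxeter system ($S$ is always finite). For $X\subseteq S$, $W_X$ is the subgroup of $W$ generated by $X$; $(W_X,X)$ is a Coxeter system. $W_X$ (or $X$) is called irreducible if there is no partition of $X$ into two non-empty subsets $X_1,X_2$ with $m_{s,t}=2$ for all $s\in X_1,t\in X_2$. $\mathcal{F}=\mathcal{F}(W,S)$ denotes the set of non-empty subsets $X\subseteq S$ such that $W_X$ is finite and irreducible.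 For $X\in\mathcal{F}$, $\omega_X$ is the unique element $\ne 1$ of $W_X$ that permutes $X$ by conjugation; it has order $2$. For $X,Y\in\mathcal{F}$ write $\omega_X(Y)=\omega_XY\omega_X$. For $X\in\mathcal{F}$ set $\Omega_0(X)=\{Y\in\mathcal{F}\mid Y\subsetneq X\}$ and $\Omega_1(X)=\{Y\in\mathcal{F}\mid Y\cup X\text{ is not irreducible}\}$. For $Y\in\Omega_0(X)$ one has $\omega_X(Y)\in\Omega_0(X)$. The cactus group $C(W,S)$ is the group with generators $c_X$, $X\in\mathcal{F}$, and relations: $(R_1)$ $c_X^2=1$ for $X\in\mathcal{F}$; $(R_2)$ $c_Xc_Y=c_{\omega_X(Y)}c_X$ for $X\in\mathcal{F}$, $Y\in\Omega_0(X)$; $(R_3)$ $c_Yc_X=c_Xc_Y$ for $X\in\mathcal{F}$, $Y\in\Omega_1(X)$. The lower central series of a group $H$ is defined by $\Gamma_1(H)=H$ and $\Gamma_{n+1}(H)=[H,\Gamma_n(H)]$; it stabilizes if $\Gamma_{n+1}(H)=\Gamma_n(H)$ for some $n\ge 1$. *)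

theory Defs
  imports "HOL-Algebra.Elementary_Groups" "HOL-Library.Extended_Nat"
begin

section \<open>Groups given by generators and relations\<close>

text \<open>The letter \<open>(a, True)\<close> stands for the generator \<open>a\<close> and \<open>(a, False)\<close> for its formal
  inverse. A relation \<open>u = v\<close> is a pair of words.\<close>

type_synonym 'a gword = "('a \<times> bool) list"

definition words_over :: "'a set \<Rightarrow> 'a gword set" where
  "words_over A = lists (A \<times> UNIV)"

definition pos_word :: "'a list \<Rightarrow> 'a gword" where
  "pos_word as = map (\<lambda>a. (a, True)) as"

inductive_set pres_cong :: "'a set \<Rightarrow> ('a gword \<times> 'a gword) set \<Rightarrow> ('a gword \<times> 'a gword) set"
  for A :: "'a set" and R :: "('a gword \<times> 'a gword) set" where
  refl: "u \<in> words_over A \<Longrightarrow> (u, u) \<in> pres_cong A R"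
| sym: "(u, v) \<in> pres_cong A R \<Longrightarrow> (v, u) \<in> pres_cong A R"
| trans: "(u, v) \<in> pres_cong A R \<Longrightarrow> (v, w) \<in> pres_cong A R \<Longrightarrow> (u, w) \<in> pres_cong A R"
| app: "(u, u') \<in> pres_cong A R \<Longrightarrow> (v, v') \<in> pres_cong A R \<Longrightarrow> (u @ v, u' @ v') \<in> pres_cong A R"
| cancel: "a \<in> A \<Longrightarrow> ([(a, b), (a, \<not> b)], []) \<in> pres_cong A R"
| rel: "(u, v) \<in> R \<Longrightarrow> u \<in> words_over A \<Longrightarrow> v \<in> words_over A \<Longrightarrow> (u, v) \<in> pres_cong A R"

definition presented_group :: "'a set \<Rightarrow> ('a gword \<times> 'a gword) set \<Rightarrow> 'a gword set monoid" where
  "presented_group A R =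
    \<lparr> carrier = words_over A // pres_cong A R,
      monoid.mult = (\<lambda>P Q. \<Union>u\<in>P. \<Union>v\<in>Q. pres_cong A R `` {u @ v}),
      monoid.one = pres_cong A R `` {[]} \<rparr>"

definition pres_gen :: "'a set \<Rightarrow> ('a gword \<times> 'a gword) set \<Rightarrow> 'a \<Rightarrow> 'a gword set" where
  "pres_gen A R a = pres_cong A R `` {pos_word [a]}"

lemma pres_cong_in_words:
  "(u, v) \<in> pres_cong A R \<Longrightarrow> u \<in> words_over A \<and> v \<in> words_over A"
  by (induction rule: pres_cong.induct) (auto simp: words_over_def)

lemma equiv_pres_cong: "equiv (words_over A) (pres_cong A R)"
proof (rule equivI)
  show "refl_on (words_over A) (pres_cong A R)"
    using pres_cong.refl by (rule refl_onI)
  show "pres_cong A R \<subseteq> words_over A \<times> words_over A"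
    by (auto dest: pres_cong_in_words)
  show "sym (pres_cong A R)"
    using pres_cong.sym by (rule symI)
  show "trans (pres_cong A R)"
    using pres_cong.trans by (rule transI)
qed

lemma presented_group_mult:
  assumes "u \<in> words_over A" "v \<in> words_over A"
  shows "pres_cong A R `` {u} \<otimes>\<^bsub>presented_group A R\<^esub> pres_cong A R `` {v}
       = pres_cong A R `` {u @ v}"
proof -
  have "pres_cong A R `` {u' @ v'} = pres_cong A R `` {u @ v}"
    if "(u, u') \<in> pres_cong A R" "(v, v') \<in> pres_cong A R" for u' v'
    using pres_cong.app[OF that] equiv_class_eq[OF equiv_pres_cong] by metis
  then have "(\<Union>u'\<in>pres_cong A R `` {u}. \<Union>v'\<in>pres_cong A R `` {v}. pres_cong A R `` {u' @ v'})
      = (\<Union>u'\<in>pres_cong A R `` {u}. \<Union>v'\<in>pres_cong A R `` {v}. pres_cong A R `` {u @ v})"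
    by (intro SUP_cong) simp_all
  moreover have "u \<in> pres_cong A R `` {u}" "v \<in> pres_cong A R `` {v}"
    using pres_cong.refl[OF assms(1)] pres_cong.refl[OF assms(2)] by simp_all
  ultimately show ?thesis
    unfolding presented_group_def by auto
qed

lemma pres_cong_inverse:
  assumes "u \<in> words_over A"
  shows "(map (\<lambda>(a, b). (a, \<not> b)) (rev u) @ u, []) \<in> pres_cong A R"
  using assms
proof (induction u)
  case Nil
  show ?case by (auto intro!: pres_cong.refl simp: words_over_def)
next
  case (Cons x u)
  obtain a b where x: "x = (a, b)" by (cases x)
  have a: "a \<in> A" and u: "u \<in> words_over A"
    using Cons.prems by (auto simp: x words_over_def)
  let ?i = "map (\<lambda>(a, b). (a, \<not> b)) (rev u)"
  have i: "?i \<in> words_over A" using u by (auto simp: words_over_def in_lists_conv_set)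
  have "([(a, \<not> b), (a, b)] @ u, [] @ u) \<in> pres_cong A R"
    using pres_cong.app[OF pres_cong.cancel[OF a, of "\<not> b" R] pres_cong.refl[OF u]] by simp
  then have "(?i @ [(a, \<not> b), (a, b)] @ u, ?i @ [] @ u) \<in> pres_cong A R"
    using pres_cong.app[OF pres_cong.refl[OF i]] by blast
  with Cons.IH[OF u] show ?case by (auto simp: x intro: pres_cong.trans)
qed

lemma group_presented_group: "group (presented_group A R)"
proof (rule groupI)
  let ?G = "presented_group A R"
  have car: "\<exists>u \<in> words_over A. P = pres_cong A R `` {u}" if "P \<in> carrier ?G" for P
    using that by (auto simp: presented_group_def elim!: quotientE)
  have carI: "pres_cong A R `` {u} \<in> carrier ?G" if "u \<in> words_over A" for u
    using that by (auto simp: presented_group_def intro: quotientI)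
  have app: "u @ v \<in> words_over A" if "u \<in> words_over A" "v \<in> words_over A" for u v :: "'a gword"
    using that by (auto simp: words_over_def)
  have nil: "[] \<in> words_over A" by (auto simp: words_over_def)
  have one: "\<one>\<^bsub>?G\<^esub> = pres_cong A R `` {[]}" by (simp add: presented_group_def)
  show "\<one>\<^bsub>?G\<^esub> \<in> carrier ?G" using carI[OF nil] by (simp add: one)
  fix x assume "x \<in> carrier ?G"
  then obtain u where u: "u \<in> words_over A" "x = pres_cong A R `` {u}" using car by blast
  show "\<one>\<^bsub>?G\<^esub> \<otimes>\<^bsub>?G\<^esub> x = x" using u nil by (simp add: one presented_group_mult)
  let ?i = "map (\<lambda>(a, b). (a, \<not> b)) (rev u)"
  have i: "?i \<in> words_over A" using u by (auto simp: words_over_def in_lists_conv_set)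
  have "pres_cong A R `` {?i} \<otimes>\<^bsub>?G\<^esub> x = \<one>\<^bsub>?G\<^esub>"
    using u i pres_cong_inverse[OF u(1)] equiv_class_eq[OF equiv_pres_cong]
    by (metis one presented_group_mult)
  then show "\<exists>y \<in> carrier ?G. y \<otimes>\<^bsub>?G\<^esub> x = \<one>\<^bsub>?G\<^esub>" using carI[OF i] by blast
  fix y assume "y \<in> carrier ?G"
  then obtain v where v: "v \<in> words_over A" "y = pres_cong A R `` {v}" using car by blast
  show "x \<otimes>\<^bsub>?G\<^esub> y \<in> carrier ?G" using u v carI app by (simp add: presented_group_mult)
  fix z assume "z \<in> carrier ?G"
  then obtain w where w: "w \<in> words_over A" "z = pres_cong A R `` {w}" using car by blast
  show "x \<otimes>\<^bsub>?G\<^esub> y \<otimes>\<^bsub>?G\<^esub> z = x \<otimes>\<^bsub>?G\<^esub> (y \<otimes>\<^bsub>?G\<^esub> z)"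
    using u v w app by (simp add: presented_group_mult)
qed

section \<open>Free products, semidirect products, lower central series\<close>

definition free_product :: "('a, 'c) monoid_scheme \<Rightarrow> ('b, 'd) monoid_scheme \<Rightarrow> ('a + 'b) gword set monoid" where
  "free_product G H = presented_group (carrier G <+> carrier H)
     ({(pos_word [Inl x, Inl y], pos_word [Inl (x \<otimes>\<^bsub>G\<^esub> y)]) | x y. x \<in> carrier G \<and> y \<in> carrier G} \<union>
      {(pos_word [Inr x, Inr y], pos_word [Inr (x \<otimes>\<^bsub>H\<^esub> y)]) | x y. x \<in> carrier H \<and> y \<in> carrier H})"

definition internal_semidirect_product :: "('a, 'b) monoid_scheme \<Rightarrow> 'a set \<Rightarrow> 'a set \<Rightarrow> bool" where
  "internal_semidirect_product G N H \<longleftrightarrow>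
     N \<lhd> G \<and> subgroup H G \<and> N \<inter> H = {\<one>\<^bsub>G\<^esub>} \<and> N <#>\<^bsub>G\<^esub> H = carrier G"

definition commutator_subgroup :: "('a, 'b) monoid_scheme \<Rightarrow> 'a set \<Rightarrow> 'a set \<Rightarrow> 'a set" where
  "commutator_subgroup G H K =
     generate G {h \<otimes>\<^bsub>G\<^esub> k \<otimes>\<^bsub>G\<^esub> inv\<^bsub>G\<^esub> h \<otimes>\<^bsub>G\<^esub> inv\<^bsub>G\<^esub> k | h k. h \<in> H \<and> k \<in> K}"

text \<open>The series starts at index 1; the value at 0 is a dummy.\<close>

fun lower_central_series :: "('a, 'b) monoid_scheme \<Rightarrow> nat \<Rightarrow> 'a set" where
  "lower_central_series G 0 = carrier G"
| "lower_central_series G (Suc 0) = carrier G"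
| "lower_central_series G (Suc (Suc n)) =
     commutator_subgroup G (carrier G) (lower_central_series G (Suc n))"

definition lower_central_series_stabilizes :: "('a, 'b) monoid_scheme \<Rightarrow> bool" where
  "lower_central_series_stabilizes G \<longleftrightarrow>
     (\<exists>n\<ge>1. lower_central_series G (n + 1) = lower_central_series G n)"

section \<open>Coxeter systems\<close>

definition coxeter_matrix :: "'s set \<Rightarrow> ('s \<Rightarrow> 's \<Rightarrow> enat) \<Rightarrow> bool" where
  "coxeter_matrix S m \<longleftrightarrow> finite S \<and>
     (\<forall>s\<in>S. \<forall>t\<in>S. m s t = m t s) \<and> (\<forall>s\<in>S. m s s = 1) \<and>
     (\<forall>s\<in>S. \<forall>t\<in>S. s \<noteq> t \<longrightarrow> 2 \<le> m s t)"

primrec Prod_word :: "'s \<Rightarrow> 's \<Rightarrow> nat \<Rightarrow> 's list" where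
  "Prod_word s t 0 = []"
| "Prod_word s t (Suc n) = s # Prod_word t s n"

definition coxeter_relations :: "'s set \<Rightarrow> ('s \<Rightarrow> 's \<Rightarrow> enat) \<Rightarrow> ('s gword \<times> 's gword) set" where
  "coxeter_relations S m =
     {(pos_word [s, s], []) | s. s \<in> S} \<union>
     {(pos_word (Prod_word t s n), pos_word (Prod_word s t n)) | s t n.
        s \<in> S \<and> t \<in> S \<and> s \<noteq> t \<and> m s t = enat n}"

definition coxeter_group :: "'s set \<Rightarrow> ('s \<Rightarrow> 's \<Rightarrow> enat) \<Rightarrow> 's gword set monoid" where
  "coxeter_group S m = presented_group S (coxeter_relations S m)"

definition cox_gen :: "'s set \<Rightarrow> ('s \<Rightarrow> 's \<Rightarrow> enat) \<Rightarrow> 's \<Rightarrow> 's gword set" where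
  "cox_gen S m = pres_gen S (coxeter_relations S m)"

definition parabolic :: "'s set \<Rightarrow> ('s \<Rightarrow> 's \<Rightarrow> enat) \<Rightarrow> 's set \<Rightarrow> 's gword set set" where
  "parabolic S m X = generate (coxeter_group S m) (cox_gen S m ` X)"

definition cox_irreducible :: "('s \<Rightarrow> 's \<Rightarrow> enat) \<Rightarrow> 's set \<Rightarrow> bool" where
  "cox_irreducible m X \<longleftrightarrow>
     \<not> (\<exists>X1 X2. X1 \<noteq> {} \<and> X2 \<noteq> {} \<and> X1 \<inter> X2 = {} \<and> X1 \<union> X2 = X \<and>
          (\<forall>s\<in>X1. \<forall>t\<in>X2. m s t = 2))"

definition fin_irr :: "'s set \<Rightarrow> ('s \<Rightarrow> 's \<Rightarrow> enat) \<Rightarrow> 's set set" where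
  "fin_irr S m =
     {X. X \<subseteq> S \<and> X \<noteq> {} \<and> finite (parabolic S m X) \<and> cox_irreducible m X}"

definition omega :: "'s set \<Rightarrow> ('s \<Rightarrow> 's \<Rightarrow> enat) \<Rightarrow> 's set \<Rightarrow> 's gword set" where
  "omega S m X =
     (THE w. w \<in> parabolic S m X \<and> w \<noteq> \<one>\<^bsub>coxeter_group S m\<^esub> \<and>
        (\<lambda>x. w \<otimes>\<^bsub>coxeter_group S m\<^esub> x \<otimes>\<^bsub>coxeter_group S m\<^esub> inv\<^bsub>coxeter_group S m\<^esub> w)
          ` (cox_gen S m ` X) = cox_gen S m ` X)"

text \<open>\<open>omega_conj S m X Y\<close> is \<open>\<omega>\<^sub>X Y \<omega>\<^sub>X\<close>, read back as a set of elements of \<open>S\<close>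
  through the embedding \<open>cox_gen S m\<close> of \<open>S\<close> into the Coxeter group.\<close>

definition omega_conj :: "'s set \<Rightarrow> ('s \<Rightarrow> 's \<Rightarrow> enat) \<Rightarrow> 's set \<Rightarrow> 's set \<Rightarrow> 's set" where
  "omega_conj S m X Y =
     {t \<in> S. cox_gen S m t \<in>
        (\<lambda>y. omega S m X \<otimes>\<^bsub>coxeter_group S m\<^esub> y \<otimes>\<^bsub>coxeter_group S m\<^esub> omega S m X)
          ` (cox_gen S m ` Y)}"

section \<open>Cactus groups\<close>

definition Omega0 :: "'s set \<Rightarrow> ('s \<Rightarrow> 's \<Rightarrow> enat) \<Rightarrow> 's set \<Rightarrow> 's set set" where
  "Omega0 S m X = {Y \<in> fin_irr S m. Y \<subset> X}"

definition Omega1 :: "'s set \<Rightarrow> ('s \<Rightarrow> 's \<Rightarrow> enat) \<Rightarrow> 's set \<Rightarrow> 's set set" where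
  "Omega1 S m X = {Y \<in> fin_irr S m. \<not> cox_irreducible m (Y \<union> X)}"

definition cactus_relations :: "'s set \<Rightarrow> ('s \<Rightarrow> 's \<Rightarrow> enat) \<Rightarrow> ('s set gword \<times> 's set gword) set" where
  "cactus_relations S m =
     {(pos_word [X, X], []) | X. X \<in> fin_irr S m} \<union>
     {(pos_word [X, Y], pos_word [omega_conj S m X Y, X]) | X Y.
        X \<in> fin_irr S m \<and> Y \<in> Omega0 S m X} \<union>
     {(pos_word [Y, X], pos_word [X, Y]) | X Y.
        X \<in> fin_irr S m \<and> Y \<in> Omega1 S m X}"

definition cactus_group :: "'s set \<Rightarrow> ('s \<Rightarrow> 's \<Rightarrow> enat) \<Rightarrow> 's set gword set monoid" where
  "cactus_group S m = presented_group (fin_irr S m) (cactus_relations S m)"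

definition cactus_gen :: "'s set \<Rightarrow> ('s \<Rightarrow> 's \<Rightarrow> enat) \<Rightarrow> 's set \<Rightarrow> 's set gword set" where
  "cactus_gen S m = pres_gen (fin_irr S m) (cactus_relations S m)"

definition cactus_sub :: "'s set \<Rightarrow> ('s \<Rightarrow> 's \<Rightarrow> enat) \<Rightarrow> 's set set \<Rightarrow> 's set gword set set" where
  "cactus_sub S m U = generate (cactus_group S m) (cactus_gen S m ` U)"

end

theory Submission
  imports Defs "HOL-Algebra.Bij" Complex_Main
begin

text \<open>Everything rests on one homomorphism. When \<open>m s t \<noteq> 2\<close> for some \<open>s \<noteq> t\<close>, there are two generators
\<open>c\<^sub>X\<close> and \<open>c\<^sub>Y\<close> of the cactus group that can be sent to the two generating involutions \<open>p\<close>, \<open>q\<close> of any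
group generated by two involutions, the other generators going to \<open>1\<close>, except possibly one that goes
to \<open>pqp\<close>. Applied to the free product of two groups of order two, this gives a homomorphism with a
section, since \<open>c\<^sub>X\<close> and \<open>c\<^sub>Y\<close> are involutions; its kernel is the normal complement. Applied to the
group of maps \<open>k \<mapsto> \<plusminus>k + j\<close> of the integers it bounds the lower central series: the \<open>n\<close>-th term
contains \<open>(c\<^sub>X c\<^sub>Y)\<close> to the power \<open>2\<^sup>n\<^sup>-\<^sup>1\<close>, whose image is a translation by \<open>\<plusminus>2\<^sup>n\<^sup>-\<^sup>1\<close>, whereas the
following term is mapped to translations by multiples of \<open>2\<^sup>n\<close>.

The sets \<open>X\<close> and \<open>Y\<close> come from the combinatorics of finite irreducible subsets
(\<open>dihedral_labelling_exists\<close>). If two different maximal ones have an irreducible union, these are the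
two sets: no conjugation relation moves a maximal set, and no commutation relation makes the two
commute. Otherwise the maximal sets are pairwise disjoint components, and one of them, \<open>M\<close>, has at
least two elements. An irreducible set with at least two elements contains at least two irreducible
sets with one element less. If conjugation by \<open>\<omega>\<^sub>M\<close> moves one of these, say \<open>Q\<close>, then \<open>X = M\<close> and
\<open>Y = Q\<close> work, with \<open>\<omega>\<^sub>M(Q)\<close> labelled \<open>pqp\<close>; if it fixes them all, two of them work.

This argument uses that conjugation by \<open>\<omega>\<^sub>V\<close> is an involutive permutation of \<open>V\<close>, hence that
\<open>\<omega>\<^sub>V\<close> exists and is unique. Both are read off from the geometric representation of the Coxeter group
on real functions on \<open>S\<close>, where the image of a simple root under \<open>w\<close> is a nonnegative combination of
simple roots if \<open>w\<close> does not get shorter by the corresponding generator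
(\<open>root_nonneg_if_len_le\<close>). An element of \<open>W\<^sub>X\<close> that permutes \<open>X\<close> by conjugation permutes the simple
roots up to sign; by irreducibility the sign is constant, and the sign \<open>+\<close> forces the element to be
\<open>1\<close>. So two such elements different from \<open>1\<close> have product \<open>1\<close>, which gives uniqueness. A longest
element of \<open>W\<^sub>X\<close> gives existence. The same representation shows that the generators are distinct and
that they commute only if \<open>m s t = 2\<close>, so that \<open>W\<close> is abelian exactly if \<open>m s t = 2\<close> for all
\<open>s \<noteq> t\<close>. In that case the finite irreducible sets are singletons and the cactus group is abelian too.\<close>

section \<open>Homomorphisms out of a presented group\<close>

definition word_val :: "('b, 'c) monoid_scheme \<Rightarrow> ('a \<Rightarrow> 'b) \<Rightarrow> 'a gword \<Rightarrow> 'b" where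
  "word_val H f u = foldr (\<lambda>(a, b) g. (if b then f a else inv\<^bsub>H\<^esub> (f a)) \<otimes>\<^bsub>H\<^esub> g) u \<one>\<^bsub>H\<^esub>"

definition gen_prod :: "('b, 'c) monoid_scheme \<Rightarrow> ('a \<Rightarrow> 'b) \<Rightarrow> 'a list \<Rightarrow> 'b" where
  "gen_prod H f as = foldr (\<lambda>a g. f a \<otimes>\<^bsub>H\<^esub> g) as \<one>\<^bsub>H\<^esub>"

lemma gen_prod_simps [simp]:
  "gen_prod H f [] = \<one>\<^bsub>H\<^esub>"
  "gen_prod H f (a # as) = f a \<otimes>\<^bsub>H\<^esub> gen_prod H f as"
  by (simp_all add: gen_prod_def)

lemma word_val_simps [simp]:
  "word_val H f [] = \<one>\<^bsub>H\<^esub>"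
  "word_val H f ((a, b) # u) = (if b then f a else inv\<^bsub>H\<^esub> (f a)) \<otimes>\<^bsub>H\<^esub> word_val H f u"
  by (simp_all add: word_val_def)

lemma word_val_pos_word: "word_val H f (pos_word as) = gen_prod H f as"
  by (induction as) (auto simp: pos_word_def)

lemma pos_word_in_words_over [simp]: "pos_word as \<in> words_over A \<longleftrightarrow> as \<in> lists A"
  by (induction as) (auto simp: pos_word_def words_over_def)

context group
begin

lemma gen_prod_closed: "f \<in> A \<rightarrow> carrier G \<Longrightarrow> as \<in> lists A \<Longrightarrow> gen_prod G f as \<in> carrier G"
  by (induction as) auto

lemma gen_prod_append:
  assumes "f \<in> A \<rightarrow> carrier G" "as \<in> lists A" "bs \<in> lists A"
  shows "gen_prod G f (as @ bs) = gen_prod G f as \<otimes> gen_prod G f bs"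
  using assms(2)
proof (induction as)
  case (Cons a as)
  then have "f a \<in> carrier G" "gen_prod G f as \<in> carrier G" "gen_prod G f bs \<in> carrier G"
    using assms gen_prod_closed[OF assms(1)] by auto
  with Cons show ?case by (simp add: m_assoc)
qed (use gen_prod_closed[OF assms(1,3)] in simp)

lemma word_val_closed: "f \<in> A \<rightarrow> carrier G \<Longrightarrow> u \<in> words_over A \<Longrightarrow> word_val G f u \<in> carrier G"
proof (induction u)
  case (Cons x u)
  then have "word_val G f u \<in> carrier G" "f (fst x) \<in> carrier G" by (auto simp: words_over_def)
  then show ?case by (cases x) auto
qed auto

lemma word_val_append:
  assumes "f \<in> A \<rightarrow> carrier G" "u \<in> words_over A" "v \<in> words_over A"
  shows "word_val G f (u @ v) = word_val G f u \<otimes> word_val G f v"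
  using assms(2)
proof (induction u)
  case (Cons x u)
  then have u: "u \<in> words_over A" and "f (fst x) \<in> carrier G"
    using assms(1) by (auto simp: words_over_def)
  then show ?case
    using Cons.IH[OF u] word_val_closed[OF assms(1) u] word_val_closed[OF assms(1,3)]
    by (cases x) (simp add: m_assoc)
qed (use word_val_closed[OF assms(1,3)] in simp)

lemma word_val_respects:
  assumes f: "f \<in> A \<rightarrow> carrier G"
    and R: "\<And>u v. (u, v) \<in> R \<Longrightarrow> u \<in> words_over A \<Longrightarrow> v \<in> words_over A \<Longrightarrow>
              word_val G f u = word_val G f v"
    and uv: "(u, v) \<in> pres_cong A R"
  shows "word_val G f u = word_val G f v"
  using uv
proof (induction rule: pres_cong.induct)
  case (app u u' v v')
  then show ?case using word_val_append[OF f] pres_cong_in_words by metis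
next
  case (cancel a b)
  then have "f a \<in> carrier G" using f by auto
  then show ?case by simp
next
  case (rel u v) then show ?case using R by blast
qed auto

text \<open>The universal property of a presentation: all homomorphisms from Coxeter groups, cactus groups and
free products below come from this statement.\<close>

lemma presented_group_hom_exists:
  assumes f: "f \<in> A \<rightarrow> carrier G"
    and R: "\<And>u v. (u, v) \<in> R \<Longrightarrow> u \<in> words_over A \<Longrightarrow> v \<in> words_over A \<Longrightarrow>
              word_val G f u = word_val G f v"
  obtains h where "h \<in> hom (presented_group A R) G" "\<And>a. a \<in> A \<Longrightarrow> h (pres_gen A R a) = f a"
proof
  define h where "h P = word_val G f (SOME u. u \<in> P)" for P
  have h: "h (pres_cong A R `` {u}) = word_val G f u" if u: "u \<in> words_over A" for u
  proof -
    have "u \<in> pres_cong A R `` {u}" using pres_cong.refl[OF u] by simp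
    then have "(SOME v. v \<in> pres_cong A R `` {u}) \<in> pres_cong A R `` {u}" by (rule someI)
    then show ?thesis unfolding h_def using word_val_respects[OF f R] by (metis Image_singleton_iff)
  qed
  show "h \<in> hom (presented_group A R) G"
  proof (rule homI)
    have car: "\<exists>u \<in> words_over A. P = pres_cong A R `` {u}" if "P \<in> carrier (presented_group A R)" for P
      using that by (auto simp: presented_group_def elim!: quotientE)
    fix P assume "P \<in> carrier (presented_group A R)"
    then obtain u where u: "u \<in> words_over A" "P = pres_cong A R `` {u}" using car by blast
    then show "h P \<in> carrier G" using h word_val_closed[OF f] by simp
    fix Q assume "Q \<in> carrier (presented_group A R)"
    then obtain v where v: "v \<in> words_over A" "Q = pres_cong A R `` {v}" using car by blast
    have "u @ v \<in> words_over A" using u v by (auto simp: words_over_def)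
    then show "h (P \<otimes>\<^bsub>presented_group A R\<^esub> Q) = h P \<otimes> h Q"
      using u v h word_val_append[OF f] by (simp add: presented_group_mult)
  qed
  show "h (pres_gen A R a) = f a" if "a \<in> A" for a
    using that h[of "pos_word [a]"] funcset_mem[OF f that]
    by (simp add: pres_gen_def word_val_pos_word)
qed

end

lemma pres_gen_closed: "a \<in> A \<Longrightarrow> pres_gen A R a \<in> carrier (presented_group A R)"
  by (auto simp: pres_gen_def presented_group_def intro!: quotientI)

text \<open>The class of a word is the product of the classes of its letters, so that relations between words
become equations in the presented group.\<close>

lemma word_val_pres_gen:
  "u \<in> words_over A \<Longrightarrow> word_val (presented_group A R) (pres_gen A R) u = pres_cong A R `` {u}"
proof (induction u)
  case Nil
  then show ?case by (simp add: presented_group_def)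
next
  case (Cons x u)
  interpret group "presented_group A R" by (rule group_presented_group)
  obtain a b where x: "x = (a, b)" by (cases x)
  have u: "u \<in> words_over A" and a: "a \<in> A" using Cons.prems by (auto simp: x words_over_def)
  have w: "[(a, b)] \<in> words_over A" for b using a by (auto simp: words_over_def)
  have "inv\<^bsub>presented_group A R\<^esub> (pres_gen A R a) = pres_cong A R `` {[(a, False)]}"
  proof (rule inv_equality)
    show "pres_cong A R `` {[(a, False)]} \<otimes>\<^bsub>presented_group A R\<^esub> pres_gen A R a = \<one>\<^bsub>presented_group A R\<^esub>"
      using presented_group_mult[OF w[of False] w[of True], of R]
        equiv_class_eq[OF equiv_pres_cong pres_cong.cancel[OF a, of False R]]
      by (simp add: pres_gen_def pos_word_def) (simp add: presented_group_def)
    show "pres_cong A R `` {[(a, False)]} \<in> carrier (presented_group A R)"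
      using w[of False] by (auto simp: presented_group_def intro!: quotientI)
  qed (rule pres_gen_closed[OF a])
  then have "(if b then pres_gen A R a else inv\<^bsub>presented_group A R\<^esub> (pres_gen A R a))
      = pres_cong A R `` {[(a, b)]}"
    by (auto simp: pres_gen_def pos_word_def)
  then show ?case using Cons.IH[OF u] presented_group_mult[OF w[of b] u, of R] by (simp add: x)
qed

lemma gen_prod_pres_gen_eq:
  assumes "(pos_word as, pos_word bs) \<in> R" "as \<in> lists A" "bs \<in> lists A"
  shows "gen_prod (presented_group A R) (pres_gen A R) as
       = gen_prod (presented_group A R) (pres_gen A R) bs"
proof -
  have "(pos_word as, pos_word bs) \<in> pres_cong A R"
    using assms by (intro pres_cong.rel) auto
  from equiv_class_eq[OF equiv_pres_cong this] show ?thesis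
    using word_val_pres_gen[of "pos_word _" A R] assms by (simp flip: word_val_pos_word)
qed

lemma presented_group_generate:
  "carrier (presented_group A R) = generate (presented_group A R) (pres_gen A R ` A)"
proof
  interpret group "presented_group A R" by (rule group_presented_group)
  show "generate (presented_group A R) (pres_gen A R ` A) \<subseteq> carrier (presented_group A R)"
    by (intro generate_incl) (auto intro: pres_gen_closed)
  have *: "word_val (presented_group A R) (pres_gen A R) u \<in> generate (presented_group A R) (pres_gen A R ` A)"
    if "u \<in> words_over A" for u
    using that
  proof (induction u)
    case (Cons x u)
    then have "u \<in> words_over A" "fst x \<in> A" by (auto simp: words_over_def)
    then show ?case using Cons.IH by (cases x) (auto intro!: generate.eng intro: generate.incl generate.inv)
  qed (auto intro: generate.one)
  show "carrier (presented_group A R) \<subseteq> generate (presented_group A R) (pres_gen A R ` A)"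
  proof
    fix P assume "P \<in> carrier (presented_group A R)"
    then obtain u where "u \<in> words_over A" "P = pres_cong A R `` {u}"
      by (auto simp: presented_group_def elim!: quotientE)
    then show "P \<in> generate (presented_group A R) (pres_gen A R ` A)"
      using *[of u] by (simp add: word_val_pres_gen)
  qed
qed

lemma hom_eq_on_generate:
  assumes "group G" "group H" "h \<in> hom G H" "k \<in> hom G H" "A \<subseteq> carrier G"
    and eq: "\<And>a. a \<in> A \<Longrightarrow> h a = k a" and x: "x \<in> generate G A"
  shows "h x = k x"
proof -
  interpret G: group G by fact
  interpret h: group_hom G H h using assms by (simp add: group_hom_def group_hom_axioms_def)
  interpret k: group_hom G H k using assms by (simp add: group_hom_def group_hom_axioms_def)
  show ?thesis using x
  proof (induction rule: generate.induct)
    case (inv a)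
    then show ?case using eq assms(5) by (metis h.hom_inv k.hom_inv subsetD)
  next
    case (eng x y)
    then show ?case using G.generate_incl[OF assms(5)] by (metis h.hom_mult k.hom_mult subsetD)
  qed (auto simp: eq)
qed

section \<open>Alternating words and Chebyshev polynomials\<close>

text \<open>The Chebyshev polynomials of the second kind, with index shifted by one. They are the coefficients of
the roots of a dihedral group.\<close>

fun cheb :: "real \<Rightarrow> nat \<Rightarrow> real" where
  "cheb c 0 = 0"
| "cheb c (Suc 0) = 1"
| "cheb c (Suc (Suc k)) = 2 * c * cheb c (Suc k) - cheb c k"

lemma cheb_cos: "cheb (cos \<theta>) k * sin \<theta> = sin (real k * \<theta>)"
proof (induction "cos \<theta>" k rule: cheb.induct)
  case (3 k)
  have "sin (real (Suc k) * \<theta> + \<theta>) + sin (real (Suc k) * \<theta> - \<theta>) = 2 * cos \<theta> * sin (real (Suc k) * \<theta>)"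
    by (simp add: sin_add sin_diff)
  moreover have "real (Suc k) * \<theta> + \<theta> = real (Suc (Suc k)) * \<theta>" "real (Suc k) * \<theta> - \<theta> = real k * \<theta>"
    by (simp_all add: algebra_simps)
  ultimately show ?case using 3 by (simp add: algebra_simps)
qed simp_all

lemma cheb_one: "cheb 1 k = real k"
  by (induction "1::real" k rule: cheb.induct) simp_all

text \<open>The alternating word of length \<open>k\<close> that ends in \<open>t\<close>. Fixing the last letter, and not the first as
\<open>Prod_word\<close> does, suits the action from the left on the simple root of \<open>s\<close>.\<close>

primrec altw :: "'s \<Rightarrow> 's \<Rightarrow> nat \<Rightarrow> 's list" where
  "altw s t 0 = []"
| "altw s t (Suc k) = (if even k then t else s) # altw s t k"

lemma length_altw [simp]: "length (altw s t k) = k"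
  by (induction k) auto

lemma set_altw: "set (altw s t k) \<subseteq> {s, t}"
  by (induction k) auto

lemma altw_Suc_right: "altw t s (Suc k) = altw s t k @ [s]"
proof (induction k)
  case (Suc k)
  have "altw t s (Suc (Suc k)) = (if even (Suc k) then s else t) # altw t s (Suc k)" by (rule altw.simps)
  also have "\<dots> = altw s t (Suc k) @ [s]" unfolding Suc.IH by simp
  finally show ?case .
qed simp

lemma altw_suffix: "\<exists>p. altw s t (j + k) = p @ altw s t k \<and> set p \<subseteq> {s, t}"
proof (induction j)
  case (Suc j)
  then obtain p where "altw s t (j + k) = p @ altw s t k" "set p \<subseteq> {s, t}" by blast
  then show ?case by (intro exI[of _ "(if even (j + k) then t else s) # p"]) auto
qed auto

lemma Prod_word_altw: "Prod_word s t n = (if even n then altw s t n else altw t s n)"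
  by (induction n arbitrary: s t) auto

text \<open>Reduced words over two involutive letters have this shape.\<close>

lemma altw_if_no_repeat:
  assumes "set u \<subseteq> {s, t}" "s \<noteq> t" "u = [] \<or> last u \<noteq> s" "\<And>p x q. u \<noteq> p @ [x, x] @ q"
  shows "u = altw s t (length u)"
  using assms
proof (induction u)
  case (Cons x u)
  show ?case
  proof (cases u)
    case Nil
    then show ?thesis using Cons.prems by auto
  next
    case (Cons y v)
    have "u = altw s t (length u)"
    proof (rule Cons.IH)
      show "u = [] \<or> last u \<noteq> s" using Cons.prems(3) Cons by auto
      show "u \<noteq> p @ [x, x] @ q" for p x q
        using Cons.prems(4)[of "_ # p" x q] by auto
    qed (use Cons.prems in auto)
    then have u: "u = altw s t (Suc (length v))" using Cons by simp
    then have "y = (if even (length v) then t else s)" using Cons by simp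
    moreover have "x \<noteq> y" using Cons.prems(4)[of "[]" x v] Cons by auto
    moreover have "x = s \<or> x = t" using Cons.prems(1) by auto
    ultimately have "x = (if even (Suc (length v)) then t else s)" by auto
    then have "x # u = altw s t (Suc (Suc (length v)))" using u by simp
    then show ?thesis using Cons by simp
  qed
qed simp

section \<open>The geometric representation\<close>

definition simple_root :: "'s \<Rightarrow> 's \<Rightarrow> real" where
  "simple_root s = (\<lambda>x. if x = s then 1 else 0)"

text \<open>The Gram matrix of the simple roots; the value \<open>-1\<close> is the limit of \<open>- cos (\<pi> / n)\<close>.\<close>

definition cosine_matrix :: "('s \<Rightarrow> 's \<Rightarrow> enat) \<Rightarrow> 's \<Rightarrow> 's \<Rightarrow> real" where
  "cosine_matrix m s t = (case m s t of enat n \<Rightarrow> - cos (pi / real n) | \<infinity> \<Rightarrow> - 1)"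

locale coxeter_system =
  fixes S :: "'s set" and m :: "'s \<Rightarrow> 's \<Rightarrow> enat"
  assumes matrix: "coxeter_matrix S m"
begin

lemma finite_S: "finite S" using matrix by (simp add: coxeter_matrix_def)

lemma m_sym: "s \<in> S \<Longrightarrow> t \<in> S \<Longrightarrow> m s t = m t s"
  using matrix by (simp add: coxeter_matrix_def)

lemma m_ge_2: "s \<in> S \<Longrightarrow> t \<in> S \<Longrightarrow> s \<noteq> t \<Longrightarrow> 2 \<le> m s t"
  using matrix by (simp add: coxeter_matrix_def)

lemma enat_ge_2: "s \<in> S \<Longrightarrow> t \<in> S \<Longrightarrow> s \<noteq> t \<Longrightarrow> m s t = enat n \<Longrightarrow> 2 \<le> n"
  using m_ge_2[of s t] by (simp add: numeral_eq_enat)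

abbreviation b where "b \<equiv> cosine_matrix m"

lemma b_sym: "s \<in> S \<Longrightarrow> t \<in> S \<Longrightarrow> b s t = b t s"
  by (simp add: cosine_matrix_def m_sym)

lemma b_self [simp]: "s \<in> S \<Longrightarrow> b s s = 1"
  using matrix by (simp add: cosine_matrix_def coxeter_matrix_def one_enat_def)

lemma b_nonpos: "s \<in> S \<Longrightarrow> t \<in> S \<Longrightarrow> s \<noteq> t \<Longrightarrow> b s t \<le> 0"
proof (cases "m s t")
  case (enat n)
  assume "s \<in> S" "t \<in> S" "s \<noteq> t"
  then have "2 \<le> n" using enat enat_ge_2 by blast
  then have "0 \<le> cos (pi / real n)"
    by (intro cos_ge_zero) (auto simp: field_simps intro: order_trans[of _ 0])
  then show ?thesis using enat by (simp add: cosine_matrix_def)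
qed (simp add: cosine_matrix_def)

lemma b_neg: "s \<in> S \<Longrightarrow> t \<in> S \<Longrightarrow> s \<noteq> t \<Longrightarrow> m s t \<noteq> 2 \<Longrightarrow> b s t < 0"
proof (cases "m s t")
  case (enat n)
  assume st: "s \<in> S" "t \<in> S" "s \<noteq> t" "m s t \<noteq> 2"
  then have "2 \<le> n" using enat enat_ge_2 by blast
  moreover have "n \<noteq> 2" using st enat by (auto simp: numeral_eq_enat)
  ultimately have "2 < n" by simp
  then have "0 < cos (pi / real n)"
    by (intro cos_gt_zero) (auto simp: field_simps)
  then show ?thesis using enat by (simp add: cosine_matrix_def)
qed (simp add: cosine_matrix_def)

definition root_pairing :: "'s \<Rightarrow> ('s \<Rightarrow> real) \<Rightarrow> real" where
  "root_pairing s v = (\<Sum>x\<in>S. v x * b x s)"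

text \<open>Vectors are functions on the index set, and those that vanish off \<open>S\<close> form the geometric
representation; functions with values outside \<open>S\<close> do no harm because \<open>root_pairing\<close> ignores them.\<close>

definition reflect :: "'s \<Rightarrow> ('s \<Rightarrow> real) \<Rightarrow> 's \<Rightarrow> real" where
  "reflect s v = (\<lambda>x. v x - 2 * root_pairing s v * simple_root s x)"

abbreviation act :: "'s list \<Rightarrow> ('s \<Rightarrow> real) \<Rightarrow> 's \<Rightarrow> real" where
  "act u v \<equiv> foldr reflect u v"

lemma root_pairing_lin:
  "root_pairing s (\<lambda>x. p * v x + q * w x) = p * root_pairing s v + q * root_pairing s w"
  by (simp add: root_pairing_def sum_distrib_left distrib_right sum.distrib mult.assoc)

lemma root_pairing_simple_root [simp]: "t \<in> S \<Longrightarrow> root_pairing s (simple_root t) = b t s"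
  using finite_S by (simp add: root_pairing_def simple_root_def if_distrib[of "\<lambda>y. y * _"] cong: if_cong)

lemma reflect_lin:
  "reflect s (\<lambda>x. p * v x + q * w x) = (\<lambda>x. p * reflect s v x + q * reflect s w x)"
  by (simp add: reflect_def root_pairing_lin algebra_simps)

lemma act_lin: "act u (\<lambda>x. p * v x + q * w x) = (\<lambda>x. p * act u v x + q * act u w x)"
  by (induction u) (simp_all add: reflect_lin)

lemma act_scale: "act u (\<lambda>x. p * v x) = (\<lambda>x. p * act u v x)"
  using act_lin[of u p v 0 v] by simp

lemma reflect_root: "s \<in> S \<Longrightarrow> reflect s (simple_root s) = (\<lambda>x. - simple_root s x)"
  by (simp add: reflect_def)

lemma root_pairing_reflect: "s \<in> S \<Longrightarrow> root_pairing s (reflect s v) = - root_pairing s v"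
  using root_pairing_lin[of s 1 v "- 2 * root_pairing s v" "simple_root s"]
  by (simp add: reflect_def)

lemma reflect_reflect [simp]: "s \<in> S \<Longrightarrow> reflect s (reflect s v) = v"
  by (rule ext) (simp add: reflect_def[of s "reflect s v"] root_pairing_reflect, simp add: reflect_def)

lemma bij_reflect: "s \<in> S \<Longrightarrow> bij (reflect s)"
  by (rule involuntory_imp_bij) simp

text \<open>Each further reflection of the dihedral group changes one of the two coordinates by the Chebyshev
recursion.\<close>

lemma act_altw:
  assumes "s \<in> S" "t \<in> S"
  shows "act (altw s t k) (simple_root s) =
    (if even k then (\<lambda>x. cheb (- b s t) (Suc k) * simple_root s x + cheb (- b s t) k * simple_root t x)
     else (\<lambda>x. cheb (- b s t) k * simple_root s x + cheb (- b s t) (Suc k) * simple_root t x))"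
proof (induction k)
  case (Suc k)
  have ts: "b t s = b s t" using assms b_sym by simp
  show ?case
  proof (cases "even k")
    case True
    then show ?thesis
      using Suc.IH assms by (simp add: reflect_lin reflect_root ts) (simp add: reflect_def algebra_simps fun_eq_iff)
  next
    case False
    then show ?thesis
      using Suc.IH assms by (simp add: reflect_lin reflect_root ts) (simp add: reflect_def algebra_simps fun_eq_iff ts)
  qed
qed simp

text \<open>Up to the factor \<open>sin (\<pi> / n)\<close> this is the sine of \<open>k\<pi> / n\<close>, an angle between \<open>0\<close> and \<open>\<pi>\<close>. For an
infinite entry the Chebyshev value is \<open>k\<close>.\<close>

lemma cheb_nonneg:
  assumes "s \<in> S" "t \<in> S" "s \<noteq> t" "\<And>n. m s t = enat n \<Longrightarrow> k \<le> n"
  shows "0 \<le> cheb (- b s t) k"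
proof (cases "m s t")
  case (enat n)
  then have n: "2 \<le> n" "k \<le> n" using assms enat_ge_2 by auto
  then have "0 < sin (pi / real n)" by (intro sin_gt_zero) (auto simp: field_simps)
  moreover have "0 \<le> sin (real k * (pi / real n))"
    using n by (intro sin_ge_zero) (auto simp: field_simps)
  ultimately show ?thesis
    using cheb_cos[of "pi / real n" k] enat
    by (simp add: cosine_matrix_def) (metis zero_le_mult_iff linorder_not_less order_less_imp_le)
qed (simp add: cosine_matrix_def cheb_one)

lemma cheb_values:
  assumes "s \<in> S" "t \<in> S" "s \<noteq> t" "m s t = enat (Suc k)"
  shows "cheb (- b s t) k = 1" "cheb (- b s t) (Suc k) = 0" "cheb (- b s t) (Suc (Suc k)) = - 1"
    "(b s t)\<^sup>2 \<noteq> 1"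
proof -
  define \<theta> where "\<theta> = pi / real (Suc k)"
  have "2 \<le> Suc k" using assms enat_ge_2 by blast
  then have pos: "0 < sin \<theta>" unfolding \<theta>_def by (intro sin_gt_zero) (auto simp: field_simps)
  have c: "- b s t = cos \<theta>" using assms by (simp add: cosine_matrix_def \<theta>_def)
  have pi: "real (Suc k) * \<theta> = pi" by (simp add: \<theta>_def)
  then have k: "real k * \<theta> = pi - \<theta>" by (simp add: algebra_simps)
  show k1: "cheb (- b s t) k = 1"
    using cheb_cos[of \<theta> k] pos unfolding c k by simp
  show k2: "cheb (- b s t) (Suc k) = 0"
    using cheb_cos[of \<theta> "Suc k"] pos unfolding c pi by simp
  show "cheb (- b s t) (Suc (Suc k)) = - 1" using k1 k2 by simp
  have "(b s t)\<^sup>2 = (cos \<theta>)\<^sup>2" by (simp flip: c)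
  moreover have "(sin \<theta>)\<^sup>2 > 0" using pos by simp
  ultimately show "(b s t)\<^sup>2 \<noteq> 1" using sin_cos_squared_add[of \<theta>] by linarith
qed

text \<open>Both words map the simple root of \<open>s\<close> to the negative of a simple root: the one ending in \<open>t\<close> by the
Chebyshev values at \<open>n\<close> and \<open>n + 1\<close>, the one ending in \<open>s\<close> because its last letter negates the root
and the remaining word is covered by the values at \<open>n - 1\<close> and \<open>n\<close>.\<close>

lemma act_altw_agree_root:
  assumes "s \<in> S" "t \<in> S" "s \<noteq> t" "m s t = enat n"
  shows "act (altw s t n) (simple_root s) = act (altw t s n) (simple_root s)"
proof -
  obtain k where n: "n = Suc k" using enat_ge_2[OF assms] by (cases n) auto
  note v = cheb_values[OF assms(1-3) assms(4)[unfolded n]]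
  have "act (altw t s n) (simple_root s) = act (altw s t k) (\<lambda>x. - 1 * simple_root s x)"
    using assms by (simp add: n altw_Suc_right reflect_root del: altw.simps)
  also have "\<dots> = (\<lambda>x. - 1 * act (altw s t k) (simple_root s) x)" by (rule act_scale)
  also have "\<dots> = act (altw s t n) (simple_root s)"
    unfolding n act_altw[OF assms(1,2)] using v by (simp del: cheb.simps)
  finally show ?thesis ..
qed

lemma act_fixes_orthogonal: "(\<And>x. x \<in> set u \<Longrightarrow> root_pairing x v = 0) \<Longrightarrow> act u v = v"
  by (induction u) (simp_all add: reflect_def)

text \<open>The braid relation. The form is nondegenerate on the plane of the two simple roots, so every vector
is the sum of one in this plane and one orthogonal to it, which both words fix.\<close>

lemma act_altw_agree:
  assumes st: "s \<in> S" "t \<in> S" "s \<noteq> t" "m s t = enat n"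
  shows "act (altw s t n) = act (altw t s n)"
proof (rule ext)
  fix v
  obtain k where n: "n = Suc k" using enat_ge_2[OF assms] by (cases n) auto
  have ne: "1 - (b s t)\<^sup>2 \<noteq> 0" using cheb_values(4)[OF st(1-3)] st(4) n by simp
  define p q where "p = root_pairing s v" and "q = root_pairing t v"
  \<comment> \<open>The coordinates of the projection of \<open>v\<close> to the plane, by the Cramer rule for the Gram matrix.\<close>
  define x y where "x = (p - b s t * q) / (1 - (b s t)\<^sup>2)" and "y = (q - b s t * p) / (1 - (b s t)\<^sup>2)"
  define r where "r = (\<lambda>z. x * simple_root s z + y * simple_root t z)"
  define w where "w = (\<lambda>z. 1 * v z + (-1) * r z)"
  have ts: "b t s = b s t" using st b_sym by simp
  have "x + b s t * y = p" "b s t * x + y = q"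
  proof -
    have "x + b s t * y = ((p - b s t * q) + b s t * (q - b s t * p)) / (1 - (b s t)\<^sup>2)"
      unfolding x_def y_def add_divide_distrib by simp
    also have "(p - b s t * q) + b s t * (q - b s t * p) = p * (1 - (b s t)\<^sup>2)"
      by (simp add: algebra_simps power2_eq_square)
    finally show "x + b s t * y = p" using ne by simp
    have "b s t * x + y = (b s t * (p - b s t * q) + (q - b s t * p)) / (1 - (b s t)\<^sup>2)"
      unfolding x_def y_def add_divide_distrib by simp
    also have "b s t * (p - b s t * q) + (q - b s t * p) = q * (1 - (b s t)\<^sup>2)"
      by (simp add: algebra_simps power2_eq_square)
    finally show "b s t * x + y = q" using ne by simp
  qed
  then have "root_pairing s w = 0" "root_pairing t w = 0"
    unfolding w_def r_def root_pairing_lin using st by (simp_all add: p_def q_def ts algebra_simps)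
  then have fix': "act (altw s t n) w = w" "act (altw t s n) w = w"
    using set_altw[of s t n] set_altw[of t s n] by (auto intro!: act_fixes_orthogonal)
  have roots: "act (altw s t n) (simple_root s) = act (altw t s n) (simple_root s)"
    "act (altw s t n) (simple_root t) = act (altw t s n) (simple_root t)"
    using act_altw_agree_root[OF st] act_altw_agree_root[of t s n] st m_sym by auto
  have v: "v = (\<lambda>z. 1 * w z + 1 * r z)" by (simp add: w_def)
  show "act (altw s t n) v = act (altw t s n) v"
    unfolding v act_lin fix' unfolding r_def act_lin roots ..
qed

abbreviation W where "W \<equiv> coxeter_group S m"
abbreviation g where "g \<equiv> cox_gen S m"

sublocale W: group W
  unfolding coxeter_group_def by (rule group_presented_group)

lemma gen_closed: "s \<in> S \<Longrightarrow> g s \<in> carrier W"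
  unfolding coxeter_group_def cox_gen_def by (rule pres_gen_closed)

lemma gen_funcset: "g \<in> S \<rightarrow> carrier W"
  using gen_closed by blast

abbreviation ev :: "'s list \<Rightarrow> 's gword set" where "ev \<equiv> gen_prod W g"

lemma ev_relation:
  "(pos_word u, pos_word v) \<in> coxeter_relations S m \<Longrightarrow> u \<in> lists S \<Longrightarrow> v \<in> lists S \<Longrightarrow> ev u = ev v"
  unfolding coxeter_group_def cox_gen_def by (rule gen_prod_pres_gen_eq)

lemma gen_square: "s \<in> S \<Longrightarrow> g s \<otimes>\<^bsub>W\<^esub> g s = \<one>\<^bsub>W\<^esub>"
proof -
  assume s: "s \<in> S"
  have "(pos_word [s, s], pos_word []) \<in> coxeter_relations S m"
    using s by (auto simp: coxeter_relations_def pos_word_def)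
  from ev_relation[OF this] show ?thesis using s gen_closed by simp
qed

lemma ev_altw:
  assumes st: "s \<in> S" "t \<in> S" "s \<noteq> t" "m s t = enat n"
  shows "ev (altw s t n) = ev (altw t s n)"
proof -
  have "(pos_word (Prod_word t s n), pos_word (Prod_word s t n)) \<in> coxeter_relations S m"
    using st by (auto simp: coxeter_relations_def)
  moreover have "altw s t n \<in> lists S" "altw t s n \<in> lists S"
    using set_altw[of s t n] set_altw[of t s n] st by auto
  ultimately show ?thesis using ev_relation by (auto simp: Prod_word_altw split: if_splits)
qed

lemma bij_act: "u \<in> lists S \<Longrightarrow> bij (act u)"
proof (induction u)
  case (Cons s u)
  moreover have "act (s # u) = reflect s \<circ> act u" by auto
  moreover have "s \<in> S" "u \<in> lists S" using Cons.prems by auto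
  ultimately show ?case using Cons.IH bij_reflect[of s] by (simp only: bij_comp)
qed (simp add: bij_id[unfolded id_def])

lemma gen_prod_reflect: "u \<in> lists S \<Longrightarrow> gen_prod (BijGroup UNIV) reflect u = act u"
proof (induction u)
  case Nil
  then show ?case by (simp add: BijGroup_def restrict_def id_def)
next
  case (Cons s u)
  then have bij: "bij (act u)" by (intro bij_act) auto
  have "s \<in> S" and "gen_prod (BijGroup UNIV) reflect u = act u" using Cons by auto
  moreover have "f \<otimes>\<^bsub>BijGroup UNIV\<^esub> h = f \<circ> h" if "bij f" "bij h" for f h :: "('s \<Rightarrow> real) \<Rightarrow> 's \<Rightarrow> real"
    using that by (simp add: BijGroup_def Bij_def compose_def extensional_def fun_eq_iff)
  ultimately have "gen_prod (BijGroup UNIV) reflect (s # u) = reflect s \<circ> act u"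
    using bij bij_reflect[of s] by simp
  then show ?case by auto
qed

definition rho :: "'s gword set \<Rightarrow> ('s \<Rightarrow> real) \<Rightarrow> 's \<Rightarrow> real" where
  "rho = (SOME h. h \<in> hom W (BijGroup UNIV) \<and> (\<forall>s\<in>S. h (g s) = reflect s))"

lemma rho: "rho \<in> hom W (BijGroup UNIV)" "s \<in> S \<Longrightarrow> rho (g s) = reflect s"
proof -
  interpret B: group "BijGroup (UNIV :: ('s \<Rightarrow> real) set)" by (rule group_BijGroup)
  have car: "reflect \<in> S \<rightarrow> carrier (BijGroup UNIV)"
    using bij_reflect by (auto simp: BijGroup_def Bij_def extensional_def)
  have R: "word_val (BijGroup UNIV) reflect u = word_val (BijGroup UNIV) reflect v"
    if "(u, v) \<in> coxeter_relations S m" for u v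
  proof -
    have "(\<exists>s\<in>S. (u, v) = (pos_word [s, s], [])) \<or>
      (\<exists>s\<in>S. \<exists>t\<in>S. \<exists>n. s \<noteq> t \<and> m s t = enat n \<and>
        (u, v) = (pos_word (Prod_word t s n), pos_word (Prod_word s t n)))"
      using that unfolding coxeter_relations_def by blast
    then consider (sq) s where "s \<in> S" "u = pos_word [s, s]" "v = pos_word []"
      | (br) s t n where "s \<in> S" "t \<in> S" "s \<noteq> t" "m s t = enat n"
          "u = pos_word (Prod_word t s n)" "v = pos_word (Prod_word s t n)"
      by (auto simp: pos_word_def)
    then show ?thesis
    proof cases
      case sq
      then have "act [s, s] = act []" by (auto simp: fun_eq_iff)
      then show ?thesis using sq gen_prod_reflect[of "[s, s]"] gen_prod_reflect[of "[]"]
        unfolding sq word_val_pos_word by simp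
    next
      case br
      have "altw s t n \<in> lists S" "altw t s n \<in> lists S"
        using set_altw[of s t n] set_altw[of t s n] br by auto
      then show ?thesis
        unfolding br word_val_pos_word
        using gen_prod_reflect act_altw_agree[OF br(1-4)] by (auto simp: Prod_word_altw)
    qed
  qed
  have ex: "\<exists>h. h \<in> hom W (BijGroup UNIV) \<and> (\<forall>s\<in>S. h (g s) = reflect s)"
    using B.presented_group_hom_exists[OF car R] unfolding coxeter_group_def cox_gen_def by metis
  from someI_ex[OF ex, folded rho_def] show "rho \<in> hom W (BijGroup UNIV)" "s \<in> S \<Longrightarrow> rho (g s) = reflect s" by auto
qed

lemma rho_hom: "group_hom W (BijGroup UNIV) rho"
  using rho(1) W.group_axioms group_BijGroup by (simp add: group_hom_def group_hom_axioms_def)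

lemma rho_mult:
  assumes "x \<in> carrier W" "y \<in> carrier W"
  shows "rho (x \<otimes>\<^bsub>W\<^esub> y) v = rho x (rho y v)"
proof -
  have "rho x \<in> carrier (BijGroup UNIV)" "rho y \<in> carrier (BijGroup UNIV)"
    using assms rho(1) by (auto simp: hom_def)
  then show ?thesis
    using hom_mult[OF rho(1) assms] by (simp add: BijGroup_def compose_def restrict_def)
qed

lemma rho_one: "rho \<one>\<^bsub>W\<^esub> v = v"
  using group_hom.hom_one[OF rho_hom] by (simp add: BijGroup_def restrict_def)

lemma rho_ev: "u \<in> lists S \<Longrightarrow> rho (ev u) = act u"
proof (induction u)
  case (Cons s u)
  then show ?case using rho_mult[OF gen_closed[of s] W.gen_prod_closed[OF gen_funcset, of u]] rho(2)[of s]
    by auto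
qed (use rho_one in auto)

lemma gen_inj: "inj_on g S"
proof (rule inj_onI)
  fix s t assume st: "s \<in> S" "t \<in> S" "g s = g t"
  then have "reflect s (simple_root s) s = reflect t (simple_root s) s" using rho(2) by metis
  then show "s = t" using st by (auto simp: reflect_root) (auto simp: reflect_def simple_root_def split: if_splits)
qed

text \<open>If \<open>m s t \<noteq> 2\<close> then the two products of reflections give the simple root of \<open>s\<close> opposite nonzero
coefficients at \<open>t\<close>.\<close>

lemma gens_commute_imp_m_eq_2:
  assumes st: "s \<in> S" "t \<in> S" "s \<noteq> t" and com: "g s \<otimes>\<^bsub>W\<^esub> g t = g t \<otimes>\<^bsub>W\<^esub> g s"
  shows "m s t = 2"
proof (rule ccontr)
  assume "m s t \<noteq> 2"
  then have neg: "b s t < 0" using b_neg st by blast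
  have ts: "b t s = b s t" using st b_sym by simp
  have "reflect s (reflect t (simple_root s)) = reflect t (reflect s (simple_root s))"
    using rho_mult[OF gen_closed gen_closed, of s t "simple_root s"]
      rho_mult[OF gen_closed gen_closed, of t s "simple_root s"] rho(2) st com by simp
  moreover have "reflect s (reflect t (simple_root s)) t = - 2 * b s t"
    using st by (simp add: reflect_def) (simp add: simple_root_def)
  moreover have "reflect t (reflect s (simple_root s)) t = 2 * b s t"
    using st root_pairing_lin[of t "-1" "simple_root s" 0 "simple_root s"]
    by (simp add: reflect_root) (simp add: reflect_def simple_root_def)
  ultimately show False using neg by simp
qed

definition form :: "('s \<Rightarrow> real) \<Rightarrow> ('s \<Rightarrow> real) \<Rightarrow> real" where
  "form v w = (\<Sum>x\<in>S. v x * root_pairing x w)"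

lemma form_sym: "form v w = form w v"
proof -
  have "form v w = (\<Sum>x\<in>S. \<Sum>y\<in>S. w y * (v x * b x y))"
    using b_sym by (auto simp: form_def root_pairing_def sum_distrib_left intro!: sum.cong)
  also have "\<dots> = form w v"
    by (subst sum.swap) (simp add: form_def root_pairing_def sum_distrib_left)
  finally show ?thesis .
qed

lemma form_lin: "form (\<lambda>x. p * v x + q * w x) z = p * form v z + q * form w z"
  by (simp add: form_def sum_distrib_left distrib_right sum.distrib mult.assoc)

lemma form_root: "s \<in> S \<Longrightarrow> form (simple_root s) w = root_pairing s w"
  using finite_S by (simp add: form_def simple_root_def if_distrib[of "\<lambda>y. y * _"] cong: if_cong)

lemma form_scale: "form (\<lambda>x. p * v x) (\<lambda>x. q * w x) = p * q * form v w"
  using form_lin[of p v 0 v "\<lambda>x. q * w x"] form_lin[of q w 0 w v] by (simp add: form_sym[of v])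

lemma form_reflect: "s \<in> S \<Longrightarrow> form (reflect s v) (reflect s w) = form v w"
proof -
  assume s: "s \<in> S"
  have lin: "form (reflect s v) z = form v z - 2 * root_pairing s v * root_pairing s z" for v z
    using form_lin[of 1 v "- 2 * root_pairing s v" "simple_root s" z] form_root[OF s]
    by (simp add: reflect_def)
  have "form v (reflect s w) = form v w - 2 * root_pairing s w * root_pairing s v"
    using lin[of w v] by (simp add: form_sym[of v])
  then show ?thesis unfolding lin root_pairing_reflect[OF s] by simp
qed

lemma form_act: "u \<in> lists S \<Longrightarrow> form (act u v) (act u w) = form v w"
  by (induction u) (auto simp: form_reflect)

end

section \<open>Length and positivity of roots\<close>

context coxeter_system
begin

lemma inv_gen: "s \<in> S \<Longrightarrow> inv\<^bsub>W\<^esub> (g s) = g s"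
  using gen_square gen_closed by (simp add: W.inv_equality)

lemma ev_closed: "u \<in> lists S \<Longrightarrow> ev u \<in> carrier W"
  by (rule W.gen_prod_closed[OF gen_funcset])

lemma ev_append: "u \<in> lists S \<Longrightarrow> v \<in> lists S \<Longrightarrow> ev (u @ v) = ev u \<otimes>\<^bsub>W\<^esub> ev v"
  by (rule W.gen_prod_append[OF gen_funcset])

lemma ev_rev: "u \<in> lists S \<Longrightarrow> ev (rev u) = inv\<^bsub>W\<^esub> (ev u)"
proof (induction u)
  case (Cons s u)
  then have "u \<in> lists S" "rev u \<in> lists S" "s \<in> S" by auto
  then show ?case using Cons.IH ev_append[of "rev u" "[s]"] ev_closed[of u] gen_closed[of s] inv_gen[of s]
    by (simp add: W.inv_mult_group)
qed simp

lemma parabolic_iff_word: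
  assumes X: "X \<subseteq> S"
  shows "w \<in> parabolic S m X \<longleftrightarrow> (\<exists>u\<in>lists X. ev u = w)"
proof
  assume "w \<in> parabolic S m X"
  then show "\<exists>u\<in>lists X. ev u = w" unfolding parabolic_def
  proof (induction rule: generate.induct)
    case one
    show ?case by (rule bexI[of _ "[]"]) auto
  next
    case (incl h)
    then obtain s where s: "s \<in> X" "h = g s" by blast
    then show ?case using X gen_closed[of s] by (intro bexI[of _ "[s]"]) auto
  next
    case (inv h)
    then obtain s where s: "s \<in> X" "h = g s" by blast
    then show ?case using X gen_closed[of s] inv_gen[of s] by (intro bexI[of _ "[s]"]) auto
  next
    case (eng h k)
    then obtain u v where "u \<in> lists X" "ev u = h" "v \<in> lists X" "ev v = k" by blast
    moreover have "u \<in> lists S" "v \<in> lists S" using calculation X by auto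
    ultimately show ?case using ev_append by (intro bexI[of _ "u @ v"]) auto
  qed
next
  assume "\<exists>u\<in>lists X. ev u = w"
  then obtain u where u: "u \<in> lists X" "ev u = w" by blast
  have "ev u \<in> generate W (g ` X)" using u(1)
  proof (induction u)
    case (Cons s u)
    then show ?case by (auto intro!: generate.eng intro: generate.incl)
  qed (auto intro: generate.one)
  then show "w \<in> parabolic S m X" using u by (simp add: parabolic_def)
qed

lemma carrier_W_eq_parabolic: "carrier W = parabolic S m S"
  unfolding parabolic_def coxeter_group_def cox_gen_def by (rule presented_group_generate)

lemma parabolic_subset: "X \<subseteq> S \<Longrightarrow> parabolic S m X \<subseteq> carrier W"
  unfolding parabolic_def using gen_closed by (intro W.generate_incl) auto

lemma parabolic_mono: "X \<subseteq> Y \<Longrightarrow> parabolic S m X \<subseteq> parabolic S m Y"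
  unfolding parabolic_def by (intro W.mono_generate image_mono)

lemma parabolic_subgroup: "X \<subseteq> S \<Longrightarrow> subgroup (parabolic S m X) W"
  unfolding parabolic_def using gen_closed by (intro W.generate_is_subgroup) auto

lemma gen_in_parabolic: "s \<in> X \<Longrightarrow> g s \<in> parabolic S m X"
  unfolding parabolic_def by (intro generate.incl) auto

lemma parabolic_mult: "X \<subseteq> S \<Longrightarrow> v \<in> parabolic S m X \<Longrightarrow> w \<in> parabolic S m X \<Longrightarrow> v \<otimes>\<^bsub>W\<^esub> w \<in> parabolic S m X"
  using parabolic_subgroup by (rule subgroup.m_closed)

lemma parabolic_inv: "X \<subseteq> S \<Longrightarrow> w \<in> parabolic S m X \<Longrightarrow> inv\<^bsub>W\<^esub> w \<in> parabolic S m X"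
  using parabolic_subgroup by (rule subgroup.m_inv_closed)

text \<open>Length with respect to words over \<open>X\<close> only. Working inside a parabolic subgroup with its own length
avoids comparing it with the length in the whole group.\<close>

definition len :: "'s set \<Rightarrow> 's gword set \<Rightarrow> nat" where
  "len X w = (LEAST k. \<exists>u\<in>lists X. length u = k \<and> ev u = w)"

lemma len_le: "u \<in> lists X \<Longrightarrow> len X (ev u) \<le> length u"
  unfolding len_def by (rule Least_le) auto

lemma reduced_word:
  assumes "X \<subseteq> S" "w \<in> parabolic S m X"
  obtains u where "u \<in> lists X" "ev u = w" "length u = len X w"
proof -
  have "\<exists>k. \<exists>u\<in>lists X. length u = k \<and> ev u = w" using assms parabolic_iff_word by blast
  from LeastI_ex[OF this] show thesis using that unfolding len_def by blast
qed

lemma len_mult: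
  assumes X: "X \<subseteq> S" and "v \<in> parabolic S m X" "w \<in> parabolic S m X"
  shows "len X (v \<otimes>\<^bsub>W\<^esub> w) \<le> len X v + len X w"
proof -
  obtain a c where ac: "a \<in> lists X" "ev a = v" "length a = len X v"
    "c \<in> lists X" "ev c = w" "length c = len X w"
    using reduced_word[OF X] assms by metis
  have "a \<in> lists S" "c \<in> lists S" using ac X by auto
  then have "ev (a @ c) = v \<otimes>\<^bsub>W\<^esub> w" using ev_append ac by simp
  then show ?thesis using len_le[of "a @ c" X] ac by simp
qed

lemma len_mono:
  assumes "Y \<subseteq> X" "X \<subseteq> S" "w \<in> parabolic S m Y"
  shows "len X w \<le> len Y w"
proof -
  obtain u where "u \<in> lists Y" "ev u = w" "length u = len Y w"
    using reduced_word[of Y w] assms by (metis order_trans)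
  then show ?thesis using len_le[of u X] assms by auto
qed

lemma len_gen: "s \<in> X \<Longrightarrow> X \<subseteq> S \<Longrightarrow> len X (g s) \<le> 1"
  using len_le[of "[s]" X] gen_closed[of s] by auto

lemma len_inv:
  assumes X: "X \<subseteq> S" and w: "w \<in> parabolic S m X"
  shows "len X (inv\<^bsub>W\<^esub> w) = len X w"
proof -
  have *: "len X (inv\<^bsub>W\<^esub> w) \<le> len X w" if w': "w \<in> parabolic S m X" for w
  proof -
    obtain u where u: "u \<in> lists X" "ev u = w" "length u = len X w"
      using reduced_word[OF X w'] by blast
    then have "u \<in> lists S" "rev u \<in> lists X" using X by auto
    then show ?thesis using len_le[of "rev u" X] u ev_rev by simp
  qed
  have "len X w \<le> len X (inv\<^bsub>W\<^esub> w)"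
    using *[OF parabolic_inv[OF X w]] W.inv_inv w parabolic_subset[OF X] by (metis subsetD)
  then show ?thesis using *[OF w] by simp
qed

lemma mult_gen_gen:
  "w \<in> carrier W \<Longrightarrow> s \<in> S \<Longrightarrow> w \<otimes>\<^bsub>W\<^esub> g s \<otimes>\<^bsub>W\<^esub> g s = w"
  using gen_closed gen_square by (simp add: W.m_assoc)

lemma rho_lin:
  assumes "w \<in> carrier W"
  shows "rho w (\<lambda>x. p * v x + q * v' x) = (\<lambda>x. p * rho w v x + q * rho w v' x)"
proof -
  obtain u where u: "u \<in> lists S" "ev u = w"
    using assms parabolic_iff_word[of S w] by (auto simp: carrier_W_eq_parabolic)
  show ?thesis unfolding u(2)[symmetric] rho_ev[OF u(1)] by (rule act_lin)
qed

lemma rho_scale: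
  assumes "w \<in> carrier W"
  shows "rho w (\<lambda>x. p * v x) = (\<lambda>x. p * rho w v x)"
  using rho_lin[OF assms, of p v 0 v] by simp

lemma rho_sum:
  assumes w: "w \<in> carrier W" and "finite A"
  shows "rho w (\<lambda>y. \<Sum>x\<in>A. c x * v x y) = (\<lambda>y. \<Sum>x\<in>A. c x * rho w (v x) y)"
  using assms(2)
proof (induction A)
  case empty
  show ?case using rho_scale[OF w, of 0] by simp
next
  case (insert a A)
  then show ?case
    using rho_lin[OF w, of "c a" "v a" 1 "\<lambda>y. \<Sum>x\<in>A. c x * v x y"] by simp
qed

lemma rho_inv:
  assumes "w \<in> carrier W"
  shows "rho (inv\<^bsub>W\<^esub> w) (rho w v) = v" "rho w (rho (inv\<^bsub>W\<^esub> w) v) = v"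
  using rho_mult[of "inv\<^bsub>W\<^esub> w" w v] rho_mult[of w "inv\<^bsub>W\<^esub> w" v] assms
  by (simp_all add: rho_one)

lemma form_rho: "w \<in> carrier W \<Longrightarrow> form (rho w v) (rho w v') = form v v'"
  using parabolic_iff_word[of S w] form_act rho_ev by (metis carrier_W_eq_parabolic subset_refl)

lemma rho_support:
  assumes X: "X \<subseteq> S" and w: "w \<in> parabolic S m X" and y: "y \<notin> X"
  shows "rho w v y = v y"
proof -
  obtain u where u: "u \<in> lists X" "ev u = w" using w parabolic_iff_word[OF X] by blast
  have "act u v y = v y" using u(1)
  proof (induction u)
    case (Cons s u)
    then show ?case using y by (auto simp: reflect_def simple_root_def)
  qed simp
  moreover have "u \<in> lists S" using u(1) X by auto
  ultimately show ?thesis using u(2) rho_ev by metis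
qed

definition nonneg :: "('s \<Rightarrow> real) \<Rightarrow> bool" where
  "nonneg v \<longleftrightarrow> (\<forall>x. 0 \<le> v x)"

definition nonpos :: "('s \<Rightarrow> real) \<Rightarrow> bool" where
  "nonpos v \<longleftrightarrow> (\<forall>x. v x \<le> 0)"

lemma nonneg_root: "nonneg (simple_root s)"
  by (simp add: nonneg_def simple_root_def)

text \<open>The image of a simple root is not zero, hence cannot have both signs.\<close>

lemma rho_root_nonzero:
  assumes "w \<in> carrier W" "nonneg (rho w (simple_root s))" "nonpos (rho w (simple_root s))"
  shows False
proof -
  have "rho w (simple_root s) x = 0" for x
    using assms(2,3) by (simp add: nonneg_def nonpos_def eq_iff)
  then have "rho w (simple_root s) = (\<lambda>x. 0 * simple_root s x)" by auto
  then have "simple_root s = rho (inv\<^bsub>W\<^esub> w) (\<lambda>x. 0 * simple_root s x)"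
    using rho_inv(1)[OF assms(1), of "simple_root s"] by simp
  also have "\<dots> = (\<lambda>x. 0)" using rho_scale[of "inv\<^bsub>W\<^esub> w" 0] assms(1) by simp
  finally have "simple_root s s = 0" by metis
  then show False by (simp add: simple_root_def)
qed

text \<open>A reduced word of \<open>z\<close> alternates. It does not end in \<open>s\<close>, and it is shorter than \<open>m s t\<close>: otherwise
the braid relation would turn it into a reduced word that ends in \<open>s\<close>. The image of the simple root is
then given by Chebyshev values in the range where they are nonnegative.\<close>

lemma dihedral_nonneg:
  assumes st: "s \<in> S" "t \<in> S" "s \<noteq> t"
    and z: "z \<in> parabolic S m {s, t}"
    and le: "len {s, t} z \<le> len {s, t} (z \<otimes>\<^bsub>W\<^esub> g s)"
  obtains p q where "0 \<le> p" "0 \<le> q"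
    "rho z (simple_root s) = (\<lambda>x. p * simple_root s x + q * simple_root t x)"
proof -
  have I: "{s, t} \<subseteq> S" using st by simp
  obtain y where y: "y \<in> lists {s, t}" "ev y = z" "length y = len {s, t} z"
    using reduced_word[OF I z] by blast
  have yS: "y \<in> lists S" using y(1) I by auto
  have no_s: False if "y' \<in> lists {s, t}" "z = ev (y' @ [s])" "length y' < length y" for y'
  proof -
    have "y' \<in> lists S" using that I by auto
    then have "z \<otimes>\<^bsub>W\<^esub> g s = ev y'"
      using that(2) ev_append[of y' "[s]"] ev_closed[of y'] st gen_closed mult_gen_gen by simp
    then show False using len_le[OF that(1)] le y(3) that(3) by simp
  qed
  have "y = altw s t (length y)"
  proof (rule altw_if_no_repeat)
    show "set y \<subseteq> {s, t}" using y(1) by auto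
    show "s \<noteq> t" by fact
    show "y = [] \<or> last y \<noteq> s"
    proof (rule ccontr)
      assume "\<not> (y = [] \<or> last y \<noteq> s)"
      then have "y = butlast y @ [s]" by (metis append_butlast_last_id)
      moreover have "butlast y \<in> lists {s, t}" using y(1) by (auto dest: in_set_butlastD)
      ultimately show False using no_s[of "butlast y"] y(2) by (metis length_append_singleton lessI)
    qed
    show "y \<noteq> p @ [x, x] @ q" for p x q
    proof
      assume eq: "y = p @ [x, x] @ q"
      then have w: "p \<in> lists S" "x \<in> S" "q \<in> lists S" "p @ q \<in> lists {s, t}" using yS y(1) by auto
      have "g x \<otimes>\<^bsub>W\<^esub> (g x \<otimes>\<^bsub>W\<^esub> ev q) = ev q"
        using w gen_closed gen_square ev_closed by (simp flip: W.m_assoc)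
      then have "ev y = ev (p @ q)"
        using w ev_append[of p "[x, x] @ q"] ev_append[of p q] eq by simp
      then show False using len_le[OF w(4)] y(2,3) eq by simp
    qed
  qed
  then obtain k where k: "y = altw s t k" "k = length y" by blast
  have kn: "k < n" if n: "m s t = enat n" for n
  proof (rule ccontr)
    assume "\<not> k < n"
    then obtain p where p: "altw s t k = p @ altw s t n" "set p \<subseteq> {s, t}"
      using altw_suffix[of s t "k - n" n] by auto
    have a: "altw s t n \<in> lists S" "altw t s n \<in> lists S" "p \<in> lists S"
      using set_altw[of s t n] set_altw[of t s n] p st by auto
    obtain j where j: "n = Suc j" using enat_ge_2[OF st n] by (cases n) auto
    have "z = ev (p @ altw t s n)"
      using y(2) k(1) p(1) ev_append a ev_altw[OF st n] by simp
    \<comment> \<open>Exchanging the two letters by the braid relation produces a word for \<open>z\<close> with last letter \<open>s\<close>.\<close>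
    then have "z = ev ((p @ altw s t j) @ [s])" unfolding j altw_Suc_right by simp
    moreover have "p @ altw s t j \<in> lists {s, t}" using p(2) set_altw[of s t j] by auto
    moreover have "length (p @ altw s t j) < length y"
      using arg_cong[OF p(1), of length] j by (simp flip: k(2))
    ultimately show False using no_s by blast
  qed
  define c where "c = - b s t"
  have nn: "0 \<le> cheb c k" "0 \<le> cheb c (Suc k)"
    unfolding c_def using cheb_nonneg[OF st, of k] cheb_nonneg[OF st, of "Suc k"] kn
    by (meson Suc_leI less_imp_le)+
  have "rho z = act (altw s t k)" using rho_ev[OF yS] y(2) k(1) by simp
  then have r: "rho z (simple_root s) = act (altw s t k) (simple_root s)" by simp
  show ?thesis
  proof (cases "even k")
    case True
    show ?thesis by (rule that[OF nn(2,1)]) (use r act_altw[OF st(1,2), of k] True in \<open>simp add: c_def\<close>)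
  next
    case False
    show ?thesis by (rule that[OF nn(1,2)]) (use r act_altw[OF st(1,2), of k] False in \<open>simp add: c_def\<close>)
  qed
qed

text \<open>By induction on the length. Let \<open>t\<close> be the last letter of a reduced word of \<open>w\<close>, and split
\<open>w = vz\<close> with \<open>z\<close> in the dihedral subgroup of \<open>s\<close> and \<open>t\<close>, lengths adding up and \<open>v\<close> as short as
possible. Then \<open>v\<close> is shorter than \<open>w\<close> and gets no shorter by \<open>s\<close> or \<open>t\<close>, so it maps both simple roots
to nonnegative vectors, and the dihedral case applies to \<open>z\<close>.\<close>

lemma root_nonneg_if_len_le:
  assumes X: "X \<subseteq> S" and "w \<in> parabolic S m X" "s \<in> X" "len X w \<le> len X (w \<otimes>\<^bsub>W\<^esub> g s)"
  shows "nonneg (rho w (simple_root s))"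
  using assms(2-)
proof (induction "len X w" arbitrary: w s rule: less_induct)
  case less
  note w = less.prems(1) and s = less.prems(2)
  have wc: "w \<in> carrier W" using w parabolic_subset[OF X] by blast
  obtain u where u: "u \<in> lists X" "ev u = w" "length u = len X w" using reduced_word[OF X w] by blast
  show ?case
  proof (cases u rule: rev_cases)
    case Nil
    then have "w = \<one>\<^bsub>W\<^esub>" using u(2) by simp
    then show ?thesis by (simp add: rho_one nonneg_root)
  next
    case (snoc u' t)
    have t: "t \<in> X" and u': "u' \<in> lists X" "u' \<in> lists S" using u(1) snoc X by auto
    have tS: "t \<in> S" "s \<in> S" using t s X by auto
    have wt: "w \<otimes>\<^bsub>W\<^esub> g t = ev u'"
      using u(2) snoc ev_append[of u' "[t]"] u' tS ev_closed[of u'] gen_closed mult_gen_gen by auto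
    have lwt: "len X (w \<otimes>\<^bsub>W\<^esub> g t) < len X w" using len_le[OF u'(1)] wt u(3) snoc by simp
    have "s \<noteq> t" using less.prems(3) lwt by auto
    have I: "{s, t} \<subseteq> S" "{s, t} \<subseteq> X" using s t X by auto
    have PI: "z \<in> parabolic S m X" if "z \<in> parabolic S m {s, t}" for z
      using that parabolic_mono[OF I(2)] by blast
    \<comment> \<open>The factors \<open>v\<close> of \<open>w\<close> for which lengths add up; the reverse inequality always holds.\<close>
    define A where "A v \<longleftrightarrow> v \<in> parabolic S m X \<and> (\<exists>z\<in>parabolic S m {s, t}.
      w = v \<otimes>\<^bsub>W\<^esub> z \<and> len X v + len {s, t} z \<le> len X w)" for v
    have "A (w \<otimes>\<^bsub>W\<^esub> g t)" unfolding A_def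
    proof (intro conjI bexI)
      show "g t \<in> parabolic S m {s, t}" by (intro gen_in_parabolic) simp
      show "w \<otimes>\<^bsub>W\<^esub> g t \<in> parabolic S m X" using X w t gen_in_parabolic parabolic_mult by blast
      show "w = w \<otimes>\<^bsub>W\<^esub> g t \<otimes>\<^bsub>W\<^esub> g t" using mult_gen_gen[OF wc tS(1)] by simp
      show "len X (w \<otimes>\<^bsub>W\<^esub> g t) + len {s, t} (g t) \<le> len X w"
        using lwt len_gen[of t "{s, t}"] I(1) by simp
    qed
    from ex_has_least_nat[of A, OF this, of "len X"]
    obtain v where Av: "A v" and min: "\<And>v'. A v' \<Longrightarrow> len X v \<le> len X v'" by blast
    obtain z where v: "v \<in> parabolic S m X" and z: "z \<in> parabolic S m {s, t}"
      and wvz: "w = v \<otimes>\<^bsub>W\<^esub> z" and lvz: "len X v + len {s, t} z \<le> len X w"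
      using Av unfolding A_def by blast
    have vc: "v \<in> carrier W" and zc: "z \<in> carrier W"
      using v z parabolic_subset[OF X] parabolic_subset[OF I(1)] by auto
    have lv: "len X v < len X w" using min[OF \<open>A (w \<otimes>\<^bsub>W\<^esub> g t)\<close>] lwt by simp
    have v_le: "len X v \<le> len X (v \<otimes>\<^bsub>W\<^esub> g r)" if r: "r \<in> {s, t}" for r
    proof (rule ccontr)
      assume less': "\<not> len X v \<le> len X (v \<otimes>\<^bsub>W\<^esub> g r)"
      have rS: "r \<in> S" and rX: "r \<in> X" using r I by auto
      have "A (v \<otimes>\<^bsub>W\<^esub> g r)" unfolding A_def
      proof (intro conjI bexI)
        show "v \<otimes>\<^bsub>W\<^esub> g r \<in> parabolic S m X" using X v rX gen_in_parabolic parabolic_mult by blast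
        show "g r \<otimes>\<^bsub>W\<^esub> z \<in> parabolic S m {s, t}" using I(1) z r gen_in_parabolic parabolic_mult by blast
        have "g r \<otimes>\<^bsub>W\<^esub> (g r \<otimes>\<^bsub>W\<^esub> z) = z" using gen_closed[OF rS] gen_square[OF rS] zc by (simp flip: W.m_assoc)
        then show "w = v \<otimes>\<^bsub>W\<^esub> g r \<otimes>\<^bsub>W\<^esub> (g r \<otimes>\<^bsub>W\<^esub> z)"
          using wvz vc zc gen_closed[OF rS] by (simp add: W.m_assoc)
        have "len {s, t} (g r \<otimes>\<^bsub>W\<^esub> z) \<le> 1 + len {s, t} z"
          using len_mult[OF I(1) gen_in_parabolic[OF r] z] len_gen[OF r I(1)] by simp
        then show "len X (v \<otimes>\<^bsub>W\<^esub> g r) + len {s, t} (g r \<otimes>\<^bsub>W\<^esub> z) \<le> len X w"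
          using less' lvz by simp
      qed
      then show False using min less' by simp
    qed
    have vs: "nonneg (rho v (simple_root s))" "nonneg (rho v (simple_root t))"
      using less.hyps[OF lv v] v_le s t by auto
    have zs: "z \<otimes>\<^bsub>W\<^esub> g s \<in> parabolic S m {s, t}"
      using I(1) z gen_in_parabolic[of s "{s, t}"] parabolic_mult by blast
    have "len {s, t} z \<le> len {s, t} (z \<otimes>\<^bsub>W\<^esub> g s)"
    proof -
      have "len X w \<le> len X (v \<otimes>\<^bsub>W\<^esub> (z \<otimes>\<^bsub>W\<^esub> g s))"
        using less.prems(3) wvz vc zc gen_closed[OF tS(2)] by (simp add: W.m_assoc)
      also have "\<dots> \<le> len X v + len {s, t} (z \<otimes>\<^bsub>W\<^esub> g s)"
        using len_mult[OF X v PI[OF zs]] len_mono[OF I(2) X zs] by simp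
      finally show ?thesis using lvz by simp
    qed
    from dihedral_nonneg[OF tS(2,1) \<open>s \<noteq> t\<close> z this] obtain p q where pq: "0 \<le> p" "0 \<le> q"
      "rho z (simple_root s) = (\<lambda>x. p * simple_root s x + q * simple_root t x)" by blast
    have "rho w (simple_root s) = (\<lambda>x. p * rho v (simple_root s) x + q * rho v (simple_root t) x)"
      using rho_mult[OF vc zc] wvz pq(3) rho_lin[OF vc] by simp
    then show ?thesis using vs pq(1,2) by (simp add: nonneg_def)
  qed
qed

lemma rho_mult_gen_root:
  assumes "w \<in> carrier W" "s \<in> S"
  shows "rho (w \<otimes>\<^bsub>W\<^esub> g s) (simple_root s) = (\<lambda>x. - rho w (simple_root s) x)"
  using rho_mult[OF assms(1) gen_closed[OF assms(2)]] rho(2)[OF assms(2)] reflect_root[OF assms(2)]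
    rho_scale[OF assms(1), of "- 1" "simple_root s"] by simp

lemma root_nonpos_if_len_ge:
  assumes X: "X \<subseteq> S" and w: "w \<in> parabolic S m X" and s: "s \<in> X"
    and "len X (w \<otimes>\<^bsub>W\<^esub> g s) \<le> len X w"
  shows "nonpos (rho w (simple_root s))"
proof -
  have wc: "w \<in> carrier W" and sS: "s \<in> S" using w s X parabolic_subset[OF X] by auto
  have "nonneg (rho (w \<otimes>\<^bsub>W\<^esub> g s) (simple_root s))"
    using assms mult_gen_gen[OF wc sS] gen_in_parabolic[OF s] parabolic_mult[OF X w]
    by (intro root_nonneg_if_len_le[OF X]) auto
  then show ?thesis unfolding rho_mult_gen_root[OF wc sS] by (simp add: nonneg_def nonpos_def)
qed

text \<open>The last letter of a nonempty reduced word would be a generator whose simple root is mapped to a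
nonpositive vector. In particular the representation is faithful.\<close>

lemma eq_one_if_roots_nonneg:
  assumes X: "X \<subseteq> S" and w: "w \<in> parabolic S m X"
    and nn: "\<And>s. s \<in> X \<Longrightarrow> nonneg (rho w (simple_root s))"
  shows "w = \<one>\<^bsub>W\<^esub>"
proof -
  obtain u where u: "u \<in> lists X" "ev u = w" "length u = len X w" using reduced_word[OF X w] by blast
  show ?thesis
  proof (cases u rule: rev_cases)
    case (snoc u' s)
    have s: "s \<in> X" "s \<in> S" and u': "u' \<in> lists X" "u' \<in> lists S" using u(1) snoc X by auto
    have ws: "w \<otimes>\<^bsub>W\<^esub> g s = ev u'"
      using u(2) snoc ev_append[of u' "[s]"] u' s ev_closed[of u'] gen_closed mult_gen_gen by auto
    then have "len X (w \<otimes>\<^bsub>W\<^esub> g s) \<le> len X w" using len_le[OF u'(1)] u(3) snoc by simp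
    from root_nonpos_if_len_ge[OF X w s(1) this] nn[OF s(1)]
    show ?thesis using rho_root_nonzero w parabolic_subset[OF X] by blast
  qed (use u in simp)
qed

lemma faithful:
  assumes "w \<in> carrier W" "\<And>v. rho w v = v"
  shows "w = \<one>\<^bsub>W\<^esub>"
  using assms nonneg_root by (intro eq_one_if_roots_nonneg[of S]) (auto simp: carrier_W_eq_parabolic)

end

section \<open>The distinguished involution of a finite irreducible parabolic subgroup\<close>

context coxeter_system
begin

definition normalizes :: "'s set \<Rightarrow> 's gword set \<Rightarrow> bool" where
  "normalizes X w \<longleftrightarrow>
    (\<lambda>x. w \<otimes>\<^bsub>W\<^esub> x \<otimes>\<^bsub>W\<^esub> inv\<^bsub>W\<^esub> w) ` (g ` X) = g ` X"

text \<open>Apply \<open>wg\<^sub>s = g\<^sub>tw\<close> to the simple root of \<open>s\<close>: its image under \<open>w\<close> is negated by the reflection of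
\<open>t\<close>, hence a multiple of the simple root of \<open>t\<close>, and the invariant form fixes the factor up to sign.\<close>

lemma root_if_conj_gen:
  assumes w: "w \<in> carrier W" and st: "s \<in> S" "t \<in> S"
    and conj: "w \<otimes>\<^bsub>W\<^esub> g s \<otimes>\<^bsub>W\<^esub> inv\<^bsub>W\<^esub> w = g t"
  obtains c where "c = 1 \<or> c = - 1" "rho w (simple_root s) = (\<lambda>x. c * simple_root t x)"
proof -
  define \<beta> c where "\<beta> = rho w (simple_root s)" and "c = root_pairing t \<beta>"
  have "g t \<otimes>\<^bsub>W\<^esub> w = w \<otimes>\<^bsub>W\<^esub> g s"
    using w gen_closed st by (simp flip: conj add: W.m_assoc)
  then have "reflect t \<beta> = (\<lambda>x. - \<beta> x)"
    using rho_mult[OF gen_closed[OF st(2)] w, of "simple_root s"] rho(2)[OF st(2)]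
      rho_mult_gen_root[OF w st(1)] by (simp add: \<beta>_def)
  then have eq: "- \<beta> x = \<beta> x - 2 * c * simple_root t x" for x
    unfolding reflect_def c_def[symmetric] by (rule fun_cong[symmetric])
  have \<beta>: "\<beta> = (\<lambda>x. c * simple_root t x)"
  proof
    show "\<beta> x = c * simple_root t x" for x using eq[of x] by simp
  qed
  have "form \<beta> \<beta> = 1" using st by (simp add: \<beta>_def form_rho[OF w] form_root)
  moreover have "form \<beta> \<beta> = c * c" unfolding \<beta> form_scale using st by (simp add: form_root)
  ultimately have "c = 1 \<or> c = - 1" using square_eq_1_iff by metis
  from that[OF this] \<beta>[unfolded \<beta>_def] show ?thesis .
qed

text \<open>The reflections agree, and the representation is faithful.\<close>

lemma conj_gen_if_root:
  assumes w: "w \<in> carrier W" and st: "s \<in> S" "t \<in> S"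
    and root: "rho w (simple_root s) = (\<lambda>x. c * simple_root t x)"
  shows "w \<otimes>\<^bsub>W\<^esub> g s \<otimes>\<^bsub>W\<^esub> inv\<^bsub>W\<^esub> w = g t"
proof -
  have "form (rho w (simple_root s)) (rho w (simple_root s)) = 1"
    using st by (simp add: form_rho[OF w] form_root)
  then have c: "c * c = 1" unfolding root form_scale using st by (simp add: form_root)
  let ?k = "w \<otimes>\<^bsub>W\<^esub> g s \<otimes>\<^bsub>W\<^esub> inv\<^bsub>W\<^esub> w"
  have cl: "?k \<in> carrier W" "g t \<in> carrier W" using w gen_closed st by auto
  have k: "rho ?k v = reflect t v" for v
  proof -
    define u where "u = rho (inv\<^bsub>W\<^esub> w) v"
    have wu: "rho w u = v" using rho_inv(2)[OF w] by (simp add: u_def)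
    have "root_pairing s u = form (rho w (simple_root s)) (rho w u)"
      using st by (simp add: form_rho[OF w] form_root)
    also have "\<dots> = c * root_pairing t v"
      using form_lin[of c "simple_root t" 0 "simple_root t" v] st unfolding root wu by (simp add: form_root)
    finally have p: "root_pairing s u = c * root_pairing t v" .
    have "rho ?k v = rho w (reflect s u)"
      using rho_mult[of "w \<otimes>\<^bsub>W\<^esub> g s" "inv\<^bsub>W\<^esub> w" v] rho_mult[of w "g s"] w gen_closed[OF st(1)] rho(2)[OF st(1)]
      by (simp add: u_def)
    also have "reflect s u = (\<lambda>x. 1 * u x + (- 2 * c * root_pairing t v) * simple_root s x)"
      by (simp add: reflect_def p mult.assoc)
    also have "rho w \<dots> = (\<lambda>x. v x - 2 * (c * c) * root_pairing t v * simple_root t x)"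
      unfolding rho_lin[OF w] root wu by (simp add: mult_ac)
    finally show ?thesis unfolding c by (simp add: reflect_def)
  qed
  have "?k \<otimes>\<^bsub>W\<^esub> g t = \<one>\<^bsub>W\<^esub>"
  proof (rule faithful)
    show "rho (?k \<otimes>\<^bsub>W\<^esub> g t) v = v" for v
      using rho_mult[OF cl] k rho(2)[OF st(2)] st by simp
  qed (use cl in simp)
  then have "?k = inv\<^bsub>W\<^esub> (g t)" using cl by (simp add: W.inv_equality)
  then show ?thesis using inv_gen st by simp
qed

lemma conj_gen_inj:
  assumes "w \<in> carrier W" "X \<subseteq> S"
  shows "inj_on (\<lambda>x. w \<otimes>\<^bsub>W\<^esub> x \<otimes>\<^bsub>W\<^esub> inv\<^bsub>W\<^esub> w) (g ` X)"
proof (rule inj_on_subset)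
  show "inj_on (\<lambda>x. w \<otimes>\<^bsub>W\<^esub> x \<otimes>\<^bsub>W\<^esub> inv\<^bsub>W\<^esub> w) (carrier W)"
    using assms(1) by (intro inj_onI) simp
qed (use assms gen_closed in auto)

text \<open>Let \<open>X1\<close> and \<open>X2\<close> be the sets of \<open>s\<close> whose simple roots keep and change their sign. If \<open>s\<close> is in \<open>X1\<close>
and \<open>t\<close> in \<open>X2\<close>, then the form of their two roots equals minus the form of two different simple roots;
since off the diagonal all entries are nonpositive, it is zero, so \<open>m s t = 2\<close>. By irreducibility one
of the two sets is empty, and it is \<open>X1\<close> because \<open>w \<noteq> 1\<close>.\<close>

lemma normalizes_roots_negative:
  assumes X: "X \<subseteq> S" and irr: "cox_irreducible m X"
    and w: "w \<in> parabolic S m X" "w \<noteq> \<one>\<^bsub>W\<^esub>" "normalizes X w" and s: "s \<in> X"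
  shows "\<exists>t\<in>X. rho w (simple_root s) = (\<lambda>x. - simple_root t x)"
proof -
  have wc: "w \<in> carrier W" using w parabolic_subset[OF X] by blast
  let ?Q = "\<lambda>s t c. t \<in> X \<and> w \<otimes>\<^bsub>W\<^esub> g s \<otimes>\<^bsub>W\<^esub> inv\<^bsub>W\<^esub> w = g t \<and> (c = 1 \<or> c = - 1) \<and>
      rho w (simple_root s) = (\<lambda>x. c * simple_root t x)"
  have "\<exists>p. ?Q s (fst p) (snd p)" if s: "s \<in> X" for s
  proof -
    have "w \<otimes>\<^bsub>W\<^esub> g s \<otimes>\<^bsub>W\<^esub> inv\<^bsub>W\<^esub> w \<in> g ` X"
      using w(3) s unfolding normalizes_def by blast
    then obtain t where t: "t \<in> X" "w \<otimes>\<^bsub>W\<^esub> g s \<otimes>\<^bsub>W\<^esub> inv\<^bsub>W\<^esub> w = g t" by blast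
    obtain c where "c = 1 \<or> c = - 1" "rho w (simple_root s) = (\<lambda>x. c * simple_root t x)"
      using root_if_conj_gen[OF wc _ _ t(2)] s t(1) X by blast
    with t have "?Q s (fst (t, c)) (snd (t, c))" by simp
    then show ?thesis by blast
  qed
  then have "\<forall>s\<in>X. \<exists>p. ?Q s (fst p) (snd p)" by blast
  from bchoice[OF this] obtain p where p: "\<forall>s\<in>X. ?Q s (fst (p s)) (snd (p s))" ..
  obtain f c where f: "\<And>s. s \<in> X \<Longrightarrow> f s \<in> X"
    and conj: "\<And>s. s \<in> X \<Longrightarrow> w \<otimes>\<^bsub>W\<^esub> g s \<otimes>\<^bsub>W\<^esub> inv\<^bsub>W\<^esub> w = g (f s)"
    and c: "\<And>s. s \<in> X \<Longrightarrow> c s = 1 \<or> c s = - 1"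
    and root: "\<And>s. s \<in> X \<Longrightarrow> rho w (simple_root s) = (\<lambda>x. c s * simple_root (f s) x)"
    by (rule that[of "fst \<circ> p" "snd \<circ> p"]) (use p in auto)
  define X1 X2 where "X1 = {s \<in> X. c s = 1}" and "X2 = {s \<in> X. c s = - 1}"
  have un: "X1 \<union> X2 = X" "X1 \<inter> X2 = {}" using c by (auto simp: X1_def X2_def)
  have m2: "m s t = 2" if "s \<in> X1" "t \<in> X2" for s t
  proof (rule ccontr)
    assume "m s t \<noteq> 2"
    have st: "s \<in> X" "t \<in> X" "s \<noteq> t" "c s = 1" "c t = - 1" using that by (auto simp: X1_def X2_def)
    have S': "s \<in> S" "t \<in> S" "f s \<in> S" "f t \<in> S" using st f X by auto
    have "f s \<noteq> f t"
    proof
      assume "f s = f t"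
      then have "w \<otimes>\<^bsub>W\<^esub> g s \<otimes>\<^bsub>W\<^esub> inv\<^bsub>W\<^esub> w = w \<otimes>\<^bsub>W\<^esub> g t \<otimes>\<^bsub>W\<^esub> inv\<^bsub>W\<^esub> w"
        using conj st by simp
      then have "g s = g t" using wc gen_closed S' by simp
      then show False using gen_inj S' st by (auto dest: inj_onD)
    qed
    have "b t s = form (rho w (simple_root s)) (rho w (simple_root t))"
      using S' by (simp add: form_rho[OF wc] form_root)
    also have "\<dots> = - b (f t) (f s)"
      using form_scale[of 1 "simple_root (f s)" "-1" "simple_root (f t)"] root st S' by (simp add: form_root)
    finally have "b t s = - b (f t) (f s)" .
    moreover have "b t s < 0" using b_neg[of s t] b_sym[of s t] S' st \<open>m s t \<noteq> 2\<close> by simp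
    moreover have "b (f t) (f s) \<le> 0" using b_nonpos S' \<open>f s \<noteq> f t\<close> by metis
    ultimately show False by simp
  qed
  have "X2 \<noteq> {}"
  proof
    assume "X2 = {}"
    then have "c s = 1" if "s \<in> X" for s using un that by (auto simp: X1_def)
    then have "w = \<one>\<^bsub>W\<^esub>"
      using root nonneg_root by (intro eq_one_if_roots_nonneg[OF X w(1)]) (simp add: nonneg_def)
    then show False using w(2) by simp
  qed
  then have "X1 = {}" using irr un m2 unfolding cox_irreducible_def by metis
  then have "c s = - 1" using un s by (auto simp: X2_def)
  then show ?thesis using root[OF s] f[OF s] by auto
qed

text \<open>The product maps simple roots to simple roots, as two signs cancel. Taking \<open>v = w\<close> shows that these
elements are involutions, and then that any two of them are equal.\<close>

lemma normalizes_unique: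
  assumes X: "X \<subseteq> S" and irr: "cox_irreducible m X"
    and w: "w \<in> parabolic S m X" "w \<noteq> \<one>\<^bsub>W\<^esub>" "normalizes X w"
    and v: "v \<in> parabolic S m X" "v \<noteq> \<one>\<^bsub>W\<^esub>" "normalizes X v"
  shows "w \<otimes>\<^bsub>W\<^esub> v = \<one>\<^bsub>W\<^esub>"
proof (rule eq_one_if_roots_nonneg[OF X parabolic_mult[OF X w(1) v(1)]])
  fix s assume s: "s \<in> X"
  have c: "w \<in> carrier W" "v \<in> carrier W" using w v parabolic_subset[OF X] by auto
  obtain t where t: "t \<in> X" "rho v (simple_root s) = (\<lambda>x. - 1 * simple_root t x)"
    using normalizes_roots_negative[OF X irr v s] by auto
  obtain r where r: "rho w (simple_root t) = (\<lambda>x. - simple_root r x)"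
    using normalizes_roots_negative[OF X irr w t(1)] by auto
  have "rho (w \<otimes>\<^bsub>W\<^esub> v) (simple_root s) = simple_root r"
    unfolding rho_mult[OF c] t(2) rho_scale[OF c(1)] r by simp
  then show "nonneg (rho (w \<otimes>\<^bsub>W\<^esub> v) (simple_root s))" using nonneg_root by simp
qed

text \<open>A longest element \<open>w\<close> and its inverse map all simple roots of \<open>X\<close> to nonpositive vectors. Expand the
image of a simple root under \<open>w\<close> in simple roots and apply the inverse: a simple root is a sum of
nonnegative vectors, which are therefore all multiples of it. So the image was a multiple of a single
simple root, which means that \<open>w\<close> conjugates the generator to a generator.\<close>

lemma longest_element_normalizes:
  assumes X: "X \<subseteq> S" and ne: "X \<noteq> {}" and fin: "finite (parabolic S m X)"
  obtains w where "w \<in> parabolic S m X" "w \<noteq> \<one>\<^bsub>W\<^esub>" "normalizes X w"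
proof -
  have "\<one>\<^bsub>W\<^esub> \<in> parabolic S m X" using subgroup.one_closed parabolic_subgroup[OF X] by metis
  then have lens: "finite (len X ` parabolic S m X)" "len X ` parabolic S m X \<noteq> {}" using fin by auto
  obtain w where w: "w \<in> parabolic S m X" and M: "Max (len X ` parabolic S m X) = len X w"
    using Max_in[OF lens] by (rule imageE)
  have max: "len X v \<le> len X w" if "v \<in> parabolic S m X" for v
    unfolding M[symmetric] using lens(1) that by (intro Max_ge) auto
  have wc: "w \<in> carrier W" using w parabolic_subset[OF X] by blast
  define w' where "w' = inv\<^bsub>W\<^esub> w"
  have w': "w' \<in> parabolic S m X" "w' \<in> carrier W" "len X w' = len X w"
    using parabolic_inv[OF X w] len_inv[OF X w] wc by (auto simp: w'_def)
  have neg: "nonpos (rho v (simple_root s))"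
    if "s \<in> X" "v \<in> parabolic S m X" "len X v = len X w" for s v
    using that max[OF parabolic_mult[OF X that(2) gen_in_parabolic[OF that(1)]]]
    by (intro root_nonpos_if_len_ge[OF X]) auto
  have conj: "w \<otimes>\<^bsub>W\<^esub> g s \<otimes>\<^bsub>W\<^esub> inv\<^bsub>W\<^esub> w \<in> g ` X" if s: "s \<in> X" for s
  proof -
    define \<beta> where "\<beta> = rho w (simple_root s)"
    have finX: "finite X" using finite_subset[OF X finite_S] .
    have supp: "\<beta> y = 0" if "y \<notin> X" for y
      using rho_support[OF X w that] that s by (auto simp: \<beta>_def simple_root_def)
    have "\<beta> = (\<lambda>y. \<Sum>x\<in>X. \<beta> x * simple_root x y)"
      using finX supp by (auto simp: simple_root_def if_distrib[of "\<lambda>y. _ * y"] cong: if_cong)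
    then have "rho w' \<beta> = rho w' (\<lambda>y. \<Sum>x\<in>X. \<beta> x * simple_root x y)" by simp
    \<comment> \<open>All products in this sum are nonnegative, as both factors are nonpositive.\<close>
    then have sum: "simple_root s = (\<lambda>y. \<Sum>x\<in>X. \<beta> x * rho w' (simple_root x) y)"
      using rho_sum[OF w'(2) finX] rho_inv(1)[OF wc] by (simp add: \<beta>_def w'_def)
    have terms: "0 \<le> \<beta> x * rho w' (simple_root x) y" if "x \<in> X" for x y
      using neg[OF s w] neg[OF that w'(1,3)] by (auto simp: nonpos_def \<beta>_def intro: mult_nonpos_nonpos)
    obtain x where x: "x \<in> X" "\<beta> x \<noteq> 0"
    proof -
      have "\<not> nonneg \<beta>" using rho_root_nonzero[OF wc] neg[OF s w] unfolding \<beta>_def by blast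
      then show ?thesis using that supp by (metis nonneg_def order_refl)
    qed
    define d where "d = rho w' (simple_root x) s"
    have "rho w' (simple_root x) y = d * simple_root s y" for y
    proof (cases "y = s")
      case False
      have "(\<Sum>x\<in>X. \<beta> x * rho w' (simple_root x) y) = 0"
        using fun_cong[OF sum, of y] False by (simp add: simple_root_def)
      then have "\<beta> x * rho w' (simple_root x) y = 0"
        using sum_nonneg_eq_0_iff[OF finX, of "\<lambda>x. \<beta> x * rho w' (simple_root x) y"] terms x(1) by simp
      then show ?thesis using x(2) False by (simp add: simple_root_def)
    qed (simp add: d_def simple_root_def)
    then have "rho w' (simple_root x) = (\<lambda>y. d * simple_root s y)" by blast
    then have "w' \<otimes>\<^bsub>W\<^esub> g x \<otimes>\<^bsub>W\<^esub> inv\<^bsub>W\<^esub> w' = g s"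
      using conj_gen_if_root[OF w'(2)] x s X by blast
    then have "w \<otimes>\<^bsub>W\<^esub> g s \<otimes>\<^bsub>W\<^esub> inv\<^bsub>W\<^esub> w = w \<otimes>\<^bsub>W\<^esub> (w' \<otimes>\<^bsub>W\<^esub> g x \<otimes>\<^bsub>W\<^esub> w) \<otimes>\<^bsub>W\<^esub> w'"
      using wc by (simp add: w'_def)
    also have "\<dots> = (w \<otimes>\<^bsub>W\<^esub> w') \<otimes>\<^bsub>W\<^esub> g x \<otimes>\<^bsub>W\<^esub> (w \<otimes>\<^bsub>W\<^esub> w')"
      using wc w'(2) gen_closed x(1) X by (simp add: W.m_assoc subset_iff)
    also have "\<dots> = g x" using wc gen_closed x(1) X by (simp add: w'_def subset_iff)
    finally show ?thesis using x(1) by blast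
  qed
  have "normalizes X w" unfolding normalizes_def
  proof (rule endo_inj_surj)
    show "finite (g ` X)" using finite_subset[OF X finite_S] by simp
    show "(\<lambda>x. w \<otimes>\<^bsub>W\<^esub> x \<otimes>\<^bsub>W\<^esub> inv\<^bsub>W\<^esub> w) ` g ` X \<subseteq> g ` X" using conj by blast
  qed (rule conj_gen_inj[OF wc X])
  moreover have "w \<noteq> \<one>\<^bsub>W\<^esub>"
  proof
    assume "w = \<one>\<^bsub>W\<^esub>"
    then have "nonneg (rho w (simple_root s))" for s by (simp add: rho_one nonneg_root)
    then show False using neg[OF _ w] rho_root_nonzero[OF wc] ne by blast
  qed
  ultimately show ?thesis using that w by blast
qed

lemma fin_irr_D:
  assumes "X \<in> fin_irr S m"
  shows "X \<subseteq> S" "X \<noteq> {}" "finite (parabolic S m X)" "cox_irreducible m X" "finite X"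
  using assms finite_subset[OF _ finite_S] by (auto simp: fin_irr_def)

lemma omega_props:
  assumes "X \<in> fin_irr S m"
  shows "omega S m X \<in> parabolic S m X" "normalizes X (omega S m X)"
    "omega S m X \<otimes>\<^bsub>W\<^esub> omega S m X = \<one>\<^bsub>W\<^esub>"
proof -
  note X = fin_irr_D[OF assms]
  let ?P = "\<lambda>w. w \<in> parabolic S m X \<and> w \<noteq> \<one>\<^bsub>W\<^esub> \<and> normalizes X w"
  obtain w where w: "?P w" using longest_element_normalizes[OF X(1-3)] by blast
  have ww: "v \<otimes>\<^bsub>W\<^esub> v' = \<one>\<^bsub>W\<^esub>" if "?P v" "?P v'" for v v'
    using normalizes_unique[OF X(1,4)] that by blast
  have "\<exists>!w. ?P w"
  proof (rule ex1I[of _ w])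
    fix v assume v: "?P v"
    have c: "v \<in> carrier W" "w \<in> carrier W" using v w parabolic_subset[OF X(1)] by auto
    have "v \<otimes>\<^bsub>W\<^esub> w = w \<otimes>\<^bsub>W\<^esub> w" using ww v w by simp
    then show "v = w" using c by simp
  qed (rule w)
  from theI'[OF this] have "?P (omega S m X)" unfolding omega_def normalizes_def .
  then show "omega S m X \<in> parabolic S m X" "normalizes X (omega S m X)"
    "omega S m X \<otimes>\<^bsub>W\<^esub> omega S m X = \<one>\<^bsub>W\<^esub>" using ww by blast+
qed

lemma omega_conj_perm:
  assumes "X \<in> fin_irr S m"
  obtains \<pi> where "\<And>s. s \<in> X \<Longrightarrow> \<pi> s \<in> X" "\<And>s. s \<in> X \<Longrightarrow> \<pi> (\<pi> s) = s"
    "\<And>Y. Y \<subseteq> X \<Longrightarrow> omega_conj S m X Y = \<pi> ` Y"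
proof -
  note X = fin_irr_D[OF assms]
  define w where "w = omega S m X"
  have wc: "w \<in> carrier W" and ww: "w \<otimes>\<^bsub>W\<^esub> w = \<one>\<^bsub>W\<^esub>" and n: "normalizes X w"
    using omega_props[OF assms] parabolic_subset[OF X(1)] by (auto simp: w_def)
  have inv: "inv\<^bsub>W\<^esub> w = w" using W.inv_equality[OF ww wc wc] .
  have gc: "g s \<in> carrier W" if "s \<in> X" for s using that X(1) gen_closed by blast
  have "\<exists>t\<in>X. w \<otimes>\<^bsub>W\<^esub> g s \<otimes>\<^bsub>W\<^esub> w = g t" if "s \<in> X" for s
    using n that unfolding normalizes_def inv by blast
  then obtain \<pi> where \<pi>: "\<And>s. s \<in> X \<Longrightarrow> \<pi> s \<in> X"
    and conj: "\<And>s. s \<in> X \<Longrightarrow> w \<otimes>\<^bsub>W\<^esub> g s \<otimes>\<^bsub>W\<^esub> w = g (\<pi> s)" by metis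
  have ginj: "s = t" if "g s = g t" "s \<in> S" "t \<in> S" for s t
    using gen_inj that by (auto dest: inj_onD)
  show ?thesis
  proof (rule that[of \<pi>])
    show "\<pi> s \<in> X" if "s \<in> X" for s using \<pi> that .
    show "\<pi> (\<pi> s) = s" if s: "s \<in> X" for s
    proof (rule ginj)
      have "g (\<pi> (\<pi> s)) = w \<otimes>\<^bsub>W\<^esub> (w \<otimes>\<^bsub>W\<^esub> g s \<otimes>\<^bsub>W\<^esub> w) \<otimes>\<^bsub>W\<^esub> w"
        using conj s \<pi> by simp
      also have "\<dots> = (w \<otimes>\<^bsub>W\<^esub> w) \<otimes>\<^bsub>W\<^esub> g s \<otimes>\<^bsub>W\<^esub> (w \<otimes>\<^bsub>W\<^esub> w)"
        using wc gc[OF s] by (simp add: W.m_assoc)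
      finally show "g (\<pi> (\<pi> s)) = g s" using ww gc[OF s] by simp
    qed (use s \<pi> X(1) in auto)
    show "omega_conj S m X Y = \<pi> ` Y" if Y: "Y \<subseteq> X" for Y
    proof -
      have "(\<lambda>y. w \<otimes>\<^bsub>W\<^esub> y \<otimes>\<^bsub>W\<^esub> w) ` g ` Y = g ` \<pi> ` Y"
        unfolding image_image using conj Y by (intro image_cong) auto
      then have "omega_conj S m X Y = {t \<in> S. g t \<in> g ` \<pi> ` Y}"
        by (simp only: omega_conj_def flip: w_def)
      also have "\<dots> = \<pi> ` Y"
      proof
        have "\<pi> ` Y \<subseteq> S" using \<pi> Y X(1) by blast
        then show "{t \<in> S. g t \<in> g ` \<pi> ` Y} \<subseteq> \<pi> ` Y" using ginj by blast
        show "\<pi> ` Y \<subseteq> {t \<in> S. g t \<in> g ` \<pi> ` Y}" using \<open>\<pi> ` Y \<subseteq> S\<close> by blast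
      qed
      finally show ?thesis .
    qed
  qed
qed

lemma omega_conj_psubset:
  assumes X: "X \<in> fin_irr S m" and Y: "Y \<subset> X"
  shows "omega_conj S m X Y \<subset> X" "card (omega_conj S m X Y) = card Y"
    "omega_conj S m X (omega_conj S m X Y) = Y"
proof -
  obtain \<pi> where \<pi>: "\<And>s. s \<in> X \<Longrightarrow> \<pi> s \<in> X" "\<And>s. s \<in> X \<Longrightarrow> \<pi> (\<pi> s) = s"
    "\<And>Y. Y \<subseteq> X \<Longrightarrow> omega_conj S m X Y = \<pi> ` Y" using omega_conj_perm[OF X] by blast
  have eq: "omega_conj S m X Y = \<pi> ` Y" using \<pi>(3) Y by blast
  have sub: "\<pi> ` Y \<subseteq> X" using \<pi>(1) Y by blast
  have inj: "inj_on \<pi> Y" using \<pi>(2) Y by (intro inj_on_inverseI[of _ \<pi>]) auto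
  show c: "card (omega_conj S m X Y) = card Y" unfolding eq using inj by (rule card_image)
  have "\<pi> ` \<pi> ` Y = Y" unfolding image_image using \<pi>(2) Y by force
  then show "omega_conj S m X (omega_conj S m X Y) = Y" unfolding eq using \<pi>(3)[OF sub] by simp
  have "card Y < card X" using Y fin_irr_D(5)[OF X] by (rule psubset_card_mono[rotated])
  then show "omega_conj S m X Y \<subset> X" using c sub unfolding eq by auto
qed

end

section \<open>Irreducible subsets and the labelling\<close>

lemma cox_irreducible_split:
  assumes "cox_irreducible m X" "X \<subseteq> A \<union> B" "A \<inter> B = {}" "\<And>s t. s \<in> A \<Longrightarrow> t \<in> B \<Longrightarrow> m s t = 2"
  shows "X \<subseteq> A \<or> X \<subseteq> B"
proof (rule ccontr)
  assume "\<not> (X \<subseteq> A \<or> X \<subseteq> B)"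
  then have "X \<inter> A \<noteq> {}" "X \<inter> B \<noteq> {}" "(X \<inter> A) \<inter> (X \<inter> B) = {}" "(X \<inter> A) \<union> (X \<inter> B) = X"
    using assms(2,3) by auto
  moreover have "\<forall>s\<in>X \<inter> A. \<forall>t\<in>X \<inter> B. m s t = 2" using assms(4) by simp
  ultimately show False using assms(1) unfolding cox_irreducible_def by metis
qed

lemma cox_irreducible_singleton: "cox_irreducible m {s}"
  unfolding cox_irreducible_def by (auto simp: Un_singleton_iff)

lemma cox_irreducible_union:
  assumes "cox_irreducible m X" "cox_irreducible m Y"
    and meet: "X \<inter> Y \<noteq> {} \<or> (\<exists>s\<in>X. \<exists>t\<in>Y. m s t \<noteq> 2 \<and> m t s \<noteq> 2)"
  shows "cox_irreducible m (X \<union> Y)"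
  unfolding cox_irreducible_def
proof (rule notI, elim exE conjE)
  fix A B
  assume AB: "A \<noteq> {}" "B \<noteq> {}" "A \<inter> B = {}" "A \<union> B = X \<union> Y" and m2: "\<forall>s\<in>A. \<forall>t\<in>B. m s t = 2"
  have "X \<subseteq> A \<or> X \<subseteq> B" using cox_irreducible_split[OF assms(1) _ AB(3)] m2 AB(4) by blast
  moreover have "Y \<subseteq> A \<or> Y \<subseteq> B" using cox_irreducible_split[OF assms(2) _ AB(3)] m2 AB(4) by blast
  ultimately consider "X \<subseteq> A" "Y \<subseteq> B" | "X \<subseteq> B" "Y \<subseteq> A" using AB by blast
  then show False using meet m2 AB(3) by cases blast+
qed

context coxeter_system
begin

lemma fin_irr_finite: "finite (fin_irr S m)"
  using finite_S by (rule finite_subset[rotated, OF finite_Pow_iff[THEN iffD2]]) (auto simp: fin_irr_def)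

lemma fin_irr_subset:
  assumes "X \<in> fin_irr S m" "Y \<subseteq> X" "Y \<noteq> {}" "cox_irreducible m Y"
  shows "Y \<in> fin_irr S m"
  using assms parabolic_mono[OF assms(2)] by (auto simp: fin_irr_def dest: finite_subset)

lemma singleton_fin_irr:
  assumes s: "s \<in> S"
  shows "{s} \<in> fin_irr S m"
proof -
  have "ev u \<in> {\<one>\<^bsub>W\<^esub>, g s}" if "u \<in> lists {s}" for u
    using that by (induction u) (use gen_closed[OF s] gen_square[OF s] in auto)
  then have "parabolic S m {s} \<subseteq> {\<one>\<^bsub>W\<^esub>, g s}" using s parabolic_iff_word[of "{s}"] by (intro subsetI) auto
  then have "finite (parabolic S m {s})" by (rule finite_subset) simp
  then show ?thesis using s cox_irreducible_singleton by (auto simp: fin_irr_def)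
qed

lemma fin_irr_maximal:
  assumes "Z \<in> fin_irr S m"
  obtains X where "X \<in> fin_irr S m" "Z \<subseteq> X" "\<And>V. V \<in> fin_irr S m \<Longrightarrow> X \<subseteq> V \<Longrightarrow> V = X"
  using finite_has_maximal2[OF fin_irr_finite assms] by metis

text \<open>Among the proper irreducible subsets that contain \<open>Z\<close> take a maximal one. Some point outside is
linked to it, and adding this point keeps it irreducible; so this point is the only one missing.\<close>

lemma irreducible_corank_one:
  assumes X: "X \<subseteq> S" "cox_irreducible m X" and Z: "Z \<subset> X" "Z \<noteq> {}" "cox_irreducible m Z"
  obtains t where "t \<in> X" "t \<notin> Z" "cox_irreducible m (X - {t})"
proof -
  define A where "A = {Y. Z \<subseteq> Y \<and> Y \<subset> X \<and> cox_irreducible m Y}"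
  have finX: "finite X" using finite_subset[OF X(1) finite_S] .
  have "finite A" by (rule finite_subset[of _ "Pow X"]) (use finX in \<open>auto simp: A_def\<close>)
  moreover have "Z \<in> A" using Z by (auto simp: A_def)
  ultimately obtain Y where Y: "Y \<in> A" and max: "\<And>V. V \<in> A \<Longrightarrow> Y \<subseteq> V \<Longrightarrow> V = Y"
    using finite_has_maximal2[of A Z] by metis
  have Y': "Z \<subseteq> Y" "Y \<subset> X" "cox_irreducible m Y" using Y by (auto simp: A_def)
  obtain s t where st: "s \<in> Y" "t \<in> X - Y" "m s t \<noteq> 2"
  proof -
    have "Y \<noteq> {}" "X - Y \<noteq> {}" "Y \<inter> (X - Y) = {}" "Y \<union> (X - Y) = X" using Y' Z(2) by auto
    then have "\<not> (\<forall>s\<in>Y. \<forall>t\<in>X - Y. m s t = 2)"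
      using X(2) unfolding cox_irreducible_def by metis
    then show ?thesis using that by blast
  qed
  have sS: "s \<in> S" "t \<in> S" using st Y' X(1) by auto
  have "cox_irreducible m (Y \<union> {t})"
  proof (rule cox_irreducible_union[OF Y'(3) cox_irreducible_singleton])
    show "Y \<inter> {t} \<noteq> {} \<or> (\<exists>s\<in>Y. \<exists>t'\<in>{t}. m s t' \<noteq> 2 \<and> m t' s \<noteq> 2)"
      using st(1,3) m_sym[OF sS] by (intro disjI2 bexI[of _ s] bexI[of _ t]) auto
  qed
  then have "Y \<union> {t} = X" using max[of "Y \<union> {t}"] st(1,2) Y' by (auto simp: A_def)
  then have "Y = X - {t}" using st(2) by auto
  then show ?thesis using that[of t] st(2) Y' by auto
qed

text \<open>The condition on \<open>X\<close>, \<open>Y\<close>, \<open>Z\<close> under which the labels \<open>p\<close>, \<open>q\<close> and \<open>pqp\<close> on these sets and \<open>1\<close> on all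
others satisfy the cactus relations for arbitrary involutions \<open>p\<close> and \<open>q\<close>. The case \<open>Z = Y\<close> stands for
a labelling that has no third set. The disjunction lists the ways in which the conjugation relation
for \<open>V\<close> and \<open>T\<close> becomes true: both sides are the label of \<open>V\<close>, both sides are the label of \<open>T\<close>, or
they express that conjugation by \<open>p\<close> exchanges \<open>q\<close> and \<open>pqp\<close>.\<close>

definition dihedral_labelling :: "'s set \<Rightarrow> 's set \<Rightarrow> 's set \<Rightarrow> bool" where
  "dihedral_labelling X Y Z \<longleftrightarrow>
    X \<in> fin_irr S m \<and> Y \<in> fin_irr S m \<and> X \<noteq> Y \<and>
    (\<forall>V\<in>{X, Y, Z}. \<forall>V'\<in>{X, Y, Z}. V \<noteq> V' \<longrightarrow> cox_irreducible m (V \<union> V')) \<and>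
    (\<forall>V\<in>fin_irr S m. \<forall>T\<in>fin_irr S m. T \<subset> V \<longrightarrow>
      T \<notin> {X, Y, Z} \<and> omega_conj S m V T \<notin> {X, Y, Z} \<or>
      V \<notin> {X, Y, Z} \<and> omega_conj S m V T = T \<or>
      V = X \<and> X \<noteq> Z \<and> Y \<noteq> Z \<and> T = Y \<and> omega_conj S m V T = Z \<or>
      V = X \<and> X \<noteq> Z \<and> Y \<noteq> Z \<and> T = Z \<and> omega_conj S m V T = Y)"

text \<open>A maximal set is neither a proper subset \<open>T\<close> of some \<open>V\<close> nor the conjugate of one.\<close>

lemma dihedral_labelling_two_maximal:
  assumes X: "X \<in> fin_irr S m" "\<And>V. V \<in> fin_irr S m \<Longrightarrow> X \<subseteq> V \<Longrightarrow> V = X"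
    and Y: "Y \<in> fin_irr S m" "\<And>V. V \<in> fin_irr S m \<Longrightarrow> Y \<subseteq> V \<Longrightarrow> V = Y"
    and XY: "X \<noteq> Y" "cox_irreducible m (X \<union> Y)"
  shows "dihedral_labelling X Y Y"
proof -
  have "T \<notin> {X, Y, Y} \<and> omega_conj S m V T \<notin> {X, Y, Y}" if "V \<in> fin_irr S m" "T \<subset> V" for V T
    using that omega_conj_psubset(1)[OF that] X(2) Y(2) by blast
  then show ?thesis using assms unfolding dihedral_labelling_def by (simp add: Un_commute)
qed

text \<open>Let \<open>K\<close> consist of the subsets of \<open>M\<close> with one element less than \<open>M\<close>. Since \<open>M\<close> is a component, \<open>M\<close> is
the only finite irreducible set that properly contains a member of \<open>K\<close>; so the labels on \<open>K\<close> meet only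
the conjugation relations of \<open>M\<close>. Two members of \<open>K\<close> have union \<open>M\<close>, which is irreducible, so no
commutation relation relates them. The conjugate of a member of \<open>K\<close> may serve as \<open>Z\<close> whether or not it
is known to be irreducible.\<close>

lemma dihedral_labelling_component:
  assumes M: "M \<in> fin_irr S m" "2 \<le> card M"
    and comp: "\<And>V. V \<in> fin_irr S m \<Longrightarrow> V \<inter> M \<noteq> {} \<Longrightarrow> V \<subseteq> M"
  obtains X Y Z where "dihedral_labelling X Y Z"
proof -
  note Mf = fin_irr_D[OF M(1)]
  define K where "K = {Q. Q \<subset> M \<and> card Q = card M - 1}"
  have K_only: "V = M" if Q: "Q \<in> K" "Q \<subset> V" and V: "V \<in> fin_irr S m" for Q V
  proof -
    have "Q \<noteq> {}" "Q \<subseteq> M" using Q M(2) by (auto simp: K_def)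
    then have VM: "V \<subseteq> M" using comp[OF V] Q(2) by blast
    then have "card Q < card V" using Q(2) Mf(5) by (meson finite_subset psubset_card_mono)
    then have "card M \<le> card V" using Q(1) by (simp add: K_def)
    then show ?thesis using VM Mf(5) by (simp add: card_seteq)
  qed
  have K_union: "Q \<union> Q' = M" if "Q \<in> K" "Q' \<in> K" "Q \<noteq> Q'" for Q Q'
  proof -
    have f: "finite (Q \<union> Q')" and sub: "Q \<union> Q' \<subseteq> M" using that Mf(5) by (auto simp: K_def intro: finite_subset)
    have "Q \<subset> Q \<union> Q'"
    proof -
      have "\<not> Q' \<subseteq> Q"
        using that f card_seteq[of Q Q'] by (auto simp: K_def)
      then show ?thesis by blast
    qed
    then have "card Q < card (Q \<union> Q')" using f by (rule psubset_card_mono[rotated])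
    then have "card M \<le> card (Q \<union> Q')" using that(1) by (simp add: K_def)
    then show ?thesis using sub Mf(5) by (simp add: card_seteq)
  qed
  have Kc: "omega_conj S m M Q \<in> K" if "Q \<in> K" for Q
    using that omega_conj_psubset[OF M(1), of Q] by (auto simp: K_def)
  have M_max: "\<not> M \<subset> V" if "V \<in> fin_irr S m" for V
    using comp[OF that] Mf(2) by blast
  obtain s where s: "s \<in> M" using Mf(2) by blast
  have single: "{x} \<subset> M" if "x \<in> M" for x using that M(2) by auto
  obtain t where t: "t \<in> M" "t \<noteq> s" "cox_irreducible m (M - {t})"
    using irreducible_corank_one[OF Mf(1,4) single[OF s] _ cox_irreducible_singleton] by blast
  obtain r where r: "r \<in> M" "r \<noteq> t" "cox_irreducible m (M - {r})"
    using irreducible_corank_one[OF Mf(1,4) single[OF t(1)] _ cox_irreducible_singleton] by blast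
  have KF: "M - {x} \<in> K" "M - {x} \<in> fin_irr S m" if "x \<in> M" "cox_irreducible m (M - {x})" for x
  proof -
    show "M - {x} \<in> K" using that(1) Mf(5) by (auto simp: K_def)
    have "M - {x} \<noteq> {}" using single[OF that(1)] by blast
    then show "M - {x} \<in> fin_irr S m" by (intro fin_irr_subset[OF M(1)]) (use that in auto)
  qed
  show ?thesis
  proof (cases "\<exists>Q\<in>K \<inter> fin_irr S m. omega_conj S m M Q \<noteq> Q")
    case True
    then obtain Q where Q: "Q \<in> K" "Q \<in> fin_irr S m" "omega_conj S m M Q \<noteq> Q" by blast
    define R where "R = omega_conj S m M Q"
    have R: "R \<in> K" "R \<noteq> Q" using Kc Q by (auto simp: R_def)
    have sub: "Q \<subset> M" "R \<subset> M" using Q(1) R(1) by (auto simp: K_def)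
    have RQ: "omega_conj S m M R = Q" using omega_conj_psubset(3)[OF M(1) sub(1)] by (simp add: R_def)
    have "dihedral_labelling M Q R" unfolding dihedral_labelling_def
    proof (intro conjI ballI impI)
      show "cox_irreducible m (V \<union> V')" if "V \<in> {M, Q, R}" "V' \<in> {M, Q, R}" "V \<noteq> V'" for V V'
      proof -
        have "V \<union> V' = M" using that sub K_union[OF Q(1) R(1)] R(2) by blast
        then show ?thesis using Mf(4) by simp
      qed
      fix V T assume V: "V \<in> fin_irr S m" and T: "T \<in> fin_irr S m" "T \<subset> V"
      define T' where "T' = omega_conj S m V T"
      have T': "T' \<subset> V" "omega_conj S m V T' = T"
        using omega_conj_psubset[OF V T(2)] by (auto simp: T'_def)
      have neM: "T \<noteq> M" "T' \<noteq> M" using M_max[OF V] T T' by auto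
      show "T \<notin> {M, Q, R} \<and> omega_conj S m V T \<notin> {M, Q, R} \<or>
        V \<notin> {M, Q, R} \<and> omega_conj S m V T = T \<or>
        V = M \<and> M \<noteq> R \<and> Q \<noteq> R \<and> T = Q \<and> omega_conj S m V T = R \<or>
        V = M \<and> M \<noteq> R \<and> Q \<noteq> R \<and> T = R \<and> omega_conj S m V T = Q"
      proof (cases "T \<in> {Q, R} \<or> T' \<in> {Q, R}")
        case True
        then have VM: "V = M" using K_only Q(1) R(1) T(2) T'(1) V by blast
        have "T = Q \<and> T' = R \<or> T = R \<and> T' = Q"
          using True RQ T'(2) unfolding T'_def R_def VM by auto
        then show ?thesis using VM R(2) sub unfolding T'_def by auto
      next
        case False
        then show ?thesis using neM unfolding T'_def by auto
      qed
    qed (use M Q sub in auto)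
    then show ?thesis by (rule that)
  next
    case False
    define Q R where "Q = M - {t}" and "R = M - {r}"
    have Q: "Q \<in> K" "Q \<in> fin_irr S m" and R: "R \<in> K" "R \<in> fin_irr S m" and ne: "Q \<noteq> R"
      using KF r t by (auto simp: Q_def R_def)
    have fixd: "omega_conj S m M Q = Q" "omega_conj S m M R = R" using False Q R by auto
    have "dihedral_labelling Q R R" unfolding dihedral_labelling_def
    proof (intro conjI ballI impI)
      show "cox_irreducible m (V \<union> V')" if "V \<in> {Q, R, R}" "V' \<in> {Q, R, R}" "V \<noteq> V'" for V V'
      proof -
        have "V \<union> V' = M" using that K_union[OF Q(1) R(1)] ne by blast
        then show ?thesis using Mf(4) by simp
      qed
      fix V T assume V: "V \<in> fin_irr S m" and T: "T \<in> fin_irr S m" "T \<subset> V"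
      define T' where "T' = omega_conj S m V T"
      have T': "T' \<subset> V" "omega_conj S m V T' = T"
        using omega_conj_psubset[OF V T(2)] by (auto simp: T'_def)
      have neM: "M \<notin> {Q, R}" using Q(1) R(1) by (auto simp: K_def)
      show "T \<notin> {Q, R, R} \<and> omega_conj S m V T \<notin> {Q, R, R} \<or>
        V \<notin> {Q, R, R} \<and> omega_conj S m V T = T \<or>
        V = Q \<and> Q \<noteq> R \<and> R \<noteq> R \<and> T = R \<and> omega_conj S m V T = R \<or>
        V = Q \<and> Q \<noteq> R \<and> R \<noteq> R \<and> T = R \<and> omega_conj S m V T = R"
      proof (cases "T \<in> {Q, R} \<or> T' \<in> {Q, R}")
        case True
        then have VM: "V = M" using K_only Q(1) R(1) T(2) T'(1) V by blast
        have "T' = T" using True fixd T'(2) unfolding T'_def VM by auto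
        then show ?thesis using VM neM unfolding T'_def by auto
      next
        case False
        then show ?thesis unfolding T'_def by auto
      qed
    qed (use Q R ne in auto)
    then show ?thesis by (rule that)
  qed
qed

text \<open>If no two different maximal sets have an irreducible union, then maximal sets containing \<open>s\<close> and \<open>t\<close>
coincide, and every finite irreducible set that meets this maximal set lies in it.\<close>

lemma dihedral_labelling_exists:
  assumes st: "s \<in> S" "t \<in> S" "s \<noteq> t" "m s t \<noteq> 2"
  obtains X Y Z where "dihedral_labelling X Y Z"
proof -
  let ?max = "\<lambda>X. X \<in> fin_irr S m \<and> (\<forall>V\<in>fin_irr S m. X \<subseteq> V \<longrightarrow> V = X)"
  obtain M where M: "?max M" "s \<in> M" using fin_irr_maximal[OF singleton_fin_irr[OF st(1)]] by (metis insert_subset)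
  obtain N where N: "?max N" "t \<in> N" using fin_irr_maximal[OF singleton_fin_irr[OF st(2)]] by (metis insert_subset)
  show ?thesis
  proof (cases "\<exists>X Y. ?max X \<and> ?max Y \<and> X \<noteq> Y \<and> cox_irreducible m (X \<union> Y)")
    case True
    then obtain X Y where "?max X" "?max Y" "X \<noteq> Y" "cox_irreducible m (X \<union> Y)" by blast
    then have "dihedral_labelling X Y Y" by (intro dihedral_labelling_two_maximal) auto
    then show ?thesis by (rule that)
  next
    case False
    have "cox_irreducible m (M \<union> N)"
    proof (rule cox_irreducible_union)
      show "cox_irreducible m M" "cox_irreducible m N" using M(1) N(1) fin_irr_D(4) by blast+
      show "M \<inter> N \<noteq> {} \<or> (\<exists>s\<in>M. \<exists>t\<in>N. m s t \<noteq> 2 \<and> m t s \<noteq> 2)"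
        using M(2) N(2) st(4) m_sym[OF st(1,2)] by metis
    qed
    then have "M = N" using False M(1) N(1) by metis
    then have "{s, t} \<subseteq> M" using M N by simp
    then have "card {s, t} \<le> card M" using fin_irr_D(5) M(1) by (intro card_mono) auto
    then have card: "2 \<le> card M" using st by simp
    have "V \<subseteq> M" if V: "V \<in> fin_irr S m" "V \<inter> M \<noteq> {}" for V
    proof -
      obtain V' where V': "?max V'" "V \<subseteq> V'" using fin_irr_maximal[OF V(1)] by metis
      have "cox_irreducible m (V' \<union> M)"
      proof (rule cox_irreducible_union)
        show "cox_irreducible m V'" "cox_irreducible m M" using M(1) V'(1) fin_irr_D(4) by blast+
        show "V' \<inter> M \<noteq> {} \<or> (\<exists>s\<in>V'. \<exists>t\<in>M. m s t \<noteq> 2 \<and> m t s \<noteq> 2)"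
          using V(2) V'(2) by blast
      qed
      then have "V' = M" using False V'(1) M(1) by metis
      then show ?thesis using V' by simp
    qed
    then show ?thesis using dihedral_labelling_component[OF _ card] M(1) that by blast
  qed
qed

end

section \<open>Commutativity and the lower central series\<close>

lemma comm_group_if_gens_commute:
  fixes G (structure)
  assumes "group G" and A: "A \<subseteq> carrier G" "carrier G = generate G A"
    and com: "\<And>a a'. a \<in> A \<Longrightarrow> a' \<in> A \<Longrightarrow> a \<otimes> a' = a' \<otimes> a"
  shows "comm_group G"
proof -
  interpret group G by fact
  have ext: "x \<otimes> y = y \<otimes> x"
    if x: "x \<in> carrier G" and xA: "\<And>a. a \<in> A \<Longrightarrow> x \<otimes> a = a \<otimes> x" and y: "y \<in> generate G A" for x y
    using y
  proof (induction rule: generate.induct)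
    case (inv a)
    then have a: "a \<in> carrier G" "x \<otimes> a = a \<otimes> x" using A xA by auto
    have "inv a \<otimes> (x \<otimes> a) \<otimes> inv a = inv a \<otimes> (a \<otimes> x) \<otimes> inv a" using a by simp
    moreover have "inv a \<otimes> (x \<otimes> a) \<otimes> inv a = inv a \<otimes> x"
      using a(1) x by (simp only: m_assoc m_closed inv_closed r_inv r_one)
    moreover have "inv a \<otimes> (a \<otimes> x) \<otimes> inv a = x \<otimes> inv a"
      using a(1) x by (simp flip: m_assoc)
    ultimately show ?case by simp
  next
    case (eng y z)
    then have "y \<in> carrier G" "z \<in> carrier G" using A by auto
    then show ?case using eng.IH x by (metis m_assoc)
  qed (use x xA in auto)
  show ?thesis
  proof (rule group_comm_groupI)
    fix x y assume xy: "x \<in> carrier G" "y \<in> carrier G"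
    have "a \<otimes> x = x \<otimes> a" if "a \<in> A" for a
      using ext[of a x] that A xy(1) com by auto
    then show "x \<otimes> y = y \<otimes> x" using ext[of x y] xy A(2) by auto
  qed
qed

text \<open>The infinite dihedral group: the pair \<open>(e, j)\<close> is the map \<open>k \<mapsto> e k + j\<close> of the integers.\<close>

definition int_affine :: "(int \<times> int) monoid" where
  "int_affine = \<lparr>carrier = {1, -1} \<times> UNIV,
     monoid.mult = (\<lambda>(e, j) (e', j'). (e * e', j + e * j')), one = (1, 0)\<rparr>"

lemma int_affine_simps [simp]:
  "(e, j) \<in> carrier int_affine \<longleftrightarrow> e = 1 \<or> e = - 1"
  "(e, j) \<otimes>\<^bsub>int_affine\<^esub> (e', j') = (e * e', j + e * j')"
  "\<one>\<^bsub>int_affine\<^esub> = (1, 0)"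
  by (auto simp: int_affine_def)

lemma group_int_affine: "group int_affine"
proof (rule groupI)
  fix x assume "x \<in> carrier int_affine"
  then obtain e j where x: "x = (e, j)" "e = 1 \<or> e = - 1" by (cases x) auto
  then show "\<exists>y\<in>carrier int_affine. y \<otimes>\<^bsub>int_affine\<^esub> x = \<one>\<^bsub>int_affine\<^esub>"
    by (intro bexI[of _ "(e, - e * j)"]) auto
qed (auto simp: algebra_simps)

text \<open>The commutator \<open>c\<close> is given by an equation without inverses, which transfers easily along
homomorphisms.\<close>

lemma int_affine_commutator:
  assumes "c \<in> carrier int_affine" "e = 1 \<or> e = - 1" "e' = 1 \<or> e' = - 1"
    and "c \<otimes>\<^bsub>int_affine\<^esub> ((e', j') \<otimes>\<^bsub>int_affine\<^esub> (e, j)) = (e, j) \<otimes>\<^bsub>int_affine\<^esub> (e', j')"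
  shows "c = (1, (1 - e') * j - (1 - e) * j')"
  using assms by (cases c) (auto simp: algebra_simps)

context group
begin

lemma lower_central_series_subgroup: "subgroup (lower_central_series G (Suc n)) G"
proof (induction n)
  case (Suc n)
  then have "lower_central_series G (Suc n) \<subseteq> carrier G" by (rule subgroup.subset)
  then show ?case unfolding lower_central_series.simps commutator_subgroup_def
    by (intro generate_is_subgroup) auto
qed (simp add: subgroup_self)

lemma lower_central_series_commutator:
  "h \<in> carrier G \<Longrightarrow> k \<in> lower_central_series G (Suc n) \<Longrightarrow>
    h \<otimes> k \<otimes> inv h \<otimes> inv k \<in> lower_central_series G (Suc (Suc n))"
  unfolding lower_central_series.simps commutator_subgroup_def by (rule generate.incl) blast

text \<open>An involution \<open>x\<close> inverts \<open>xy\<close> by conjugation, so its commutator with a power of \<open>xy\<close> is the inverse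
of the square of this power.\<close>

lemma lower_central_series_powers:
  assumes x: "x \<in> carrier G" "x \<otimes> x = \<one>" and y: "y \<in> carrier G" "y \<otimes> y = \<one>"
  shows "(x \<otimes> y) [^] (2 ^ n :: nat) \<in> lower_central_series G (Suc n)"
proof (induction n)
  case 0
  show ?case using x y by simp
next
  case (Suc n)
  let ?p = "x \<otimes> y" and ?k = "2 ^ n :: nat"
  have p: "?p \<in> carrier G" using x y by simp
  have inv: "inv x = x" "inv y = y" using x y by (simp_all add: inv_equality)
  have "x \<otimes> ?p [^] k \<otimes> x = (y \<otimes> x) [^] k" for k :: nat
  proof (induction k)
    case (Suc k)
    have "x \<otimes> ?p [^] Suc k \<otimes> x = (x \<otimes> ?p [^] k \<otimes> x) \<otimes> (y \<otimes> x)"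
      using x y by (simp add: m_assoc)
    then show ?case using Suc by simp
  qed (use x in simp)
  moreover have "y \<otimes> x = inv ?p" using x y inv by (simp add: inv_mult_group)
  ultimately have conj: "x \<otimes> ?p [^] ?k \<otimes> inv x = inv (?p [^] ?k)"
    using inv p by (simp add: nat_pow_inv)
  have "x \<otimes> ?p [^] ?k \<otimes> inv x \<otimes> inv (?p [^] ?k) = inv (?p [^] (2 ^ Suc n :: nat))"
    unfolding conj using p by (simp add: mult_2 nat_pow_mult flip: inv_mult_group)
  then have "inv (?p [^] (2 ^ Suc n :: nat)) \<in> lower_central_series G (Suc (Suc n))"
    using lower_central_series_commutator[OF x(1) Suc] by simp
  then have "inv (inv (?p [^] (2 ^ Suc n :: nat))) \<in> lower_central_series G (Suc (Suc n))"
    by (rule subgroup.m_inv_closed[OF lower_central_series_subgroup])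
  then show ?case using p by simp
qed

text \<open>The commutator of any two maps is a translation by an even number, and that of any map with a
translation by \<open>d\<close> is a translation by \<open>0\<close> or \<open>-2d\<close>.\<close>

lemma lower_central_series_translations:
  assumes \<chi>: "\<chi> \<in> hom G int_affine" and w: "w \<in> lower_central_series G (Suc (Suc n))"
  shows "\<exists>i. \<chi> w = (1, 2 ^ Suc n * i)"
  using w
proof (induction n arbitrary: w)
  have hom: "group_hom G int_affine \<chi>"
    using \<chi> group_int_affine by (simp add: group_hom_def group_hom_axioms_def)
  have commutator: "\<chi> (h \<otimes> k \<otimes> inv h \<otimes> inv k) = (1, (1 - e') * j - (1 - e) * j')"
    if hk: "h \<in> carrier G" "k \<in> carrier G" "\<chi> h = (e, j)" "\<chi> k = (e', j')" for h k e e' j j'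
  proof (rule int_affine_commutator)
    let ?c = "h \<otimes> k \<otimes> inv h \<otimes> inv k"
    have c: "?c \<in> carrier G" using hk by simp
    then show "\<chi> ?c \<in> carrier int_affine" using \<chi> by (rule hom_in_carrier[rotated])
    have "(e, j) \<in> carrier int_affine" "(e', j') \<in> carrier int_affine"
      using hk hom_in_carrier[OF \<chi>] by metis+
    then show "e = 1 \<or> e = - 1" "e' = 1 \<or> e' = - 1" by simp_all
    have "?c \<otimes> (k \<otimes> h) = h \<otimes> k" using hk by (simp add: m_assoc inv_solve_left')
    then have "\<chi> (?c \<otimes> (k \<otimes> h)) = \<chi> (h \<otimes> k)" by simp
    then show "\<chi> ?c \<otimes>\<^bsub>int_affine\<^esub> ((e', j') \<otimes>\<^bsub>int_affine\<^esub> (e, j)) = (e, j) \<otimes>\<^bsub>int_affine\<^esub> (e', j')"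
      using c hk hom_mult[OF \<chi>] by (simp del: int_affine_simps)
  qed
  have gen: "\<exists>i. \<chi> w = (1, d * i)"
    if w: "w \<in> generate G A" and A: "A \<subseteq> carrier G" "\<And>a. a \<in> A \<Longrightarrow> \<exists>i. \<chi> a = (1, d * i)" for w A d
    using w
  proof (induction rule: generate.induct)
    case one
    show ?case using group_hom.hom_one[OF hom] by (intro exI[of _ 0]) simp
  next
    case (inv a)
    then obtain i where i: "\<chi> a = (1, d * i)" using A by blast
    have "inv\<^bsub>int_affine\<^esub> (1, d * i) = (1, d * - i)"
      by (rule group.inv_equality[OF group_int_affine]) auto
    then show ?case using group_hom.hom_inv[OF hom, of a] inv A(1) i by (intro exI[of _ "- i"]) auto
  next
    case (eng v w)
    then obtain i j where "\<chi> v = (1, d * i)" "\<chi> w = (1, d * j)" by blast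
    moreover have "v \<in> carrier G" "w \<in> carrier G" using eng generate_incl[OF A(1)] by auto
    ultimately show ?case
      using hom_mult[OF \<chi>, of v w] by (intro exI[of _ "i + j"]) (simp add: algebra_simps)
  qed (use A in blast)
  {
    case 0
    show ?case
    proof (rule gen)
      show "w \<in> generate G {h \<otimes> k \<otimes> inv h \<otimes> inv k | h k. h \<in> carrier G \<and> k \<in> lower_central_series G (Suc 0)}"
        using 0 by (simp add: commutator_subgroup_def)
      fix a assume "a \<in> {h \<otimes> k \<otimes> inv h \<otimes> inv k | h k. h \<in> carrier G \<and> k \<in> lower_central_series G (Suc 0)}"
      then obtain h k where a: "a = h \<otimes> k \<otimes> inv h \<otimes> inv k" "h \<in> carrier G" "k \<in> carrier G" by auto
      obtain e j e' j' where ej: "\<chi> h = (e, j)" "\<chi> k = (e', j')" by (metis surj_pair)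
      have "(e, j) \<in> carrier int_affine" "(e', j') \<in> carrier int_affine"
        using a ej hom_in_carrier[OF \<chi>] by metis+
      then have "even ((1 - e') * j - (1 - e) * j')" by auto
      then obtain i where i: "(1 - e') * j - (1 - e) * j' = 2 * i" by (rule evenE)
      then show "\<exists>i. \<chi> a = (1, 2 ^ Suc 0 * i)"
        unfolding a(1) commutator[OF a(2,3) ej] i by simp
    qed auto
  next
    case (Suc n)
    have sub: "lower_central_series G (Suc (Suc n)) \<subseteq> carrier G"
      using lower_central_series_subgroup by (rule subgroup.subset)
    show ?case
    proof (rule gen)
      show "w \<in> generate G {h \<otimes> k \<otimes> inv h \<otimes> inv k | h k. h \<in> carrier G \<and> k \<in> lower_central_series G (Suc (Suc n))}"
        using Suc.prems by (simp add: commutator_subgroup_def)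
      fix a assume "a \<in> {h \<otimes> k \<otimes> inv h \<otimes> inv k | h k. h \<in> carrier G \<and> k \<in> lower_central_series G (Suc (Suc n))}"
      then obtain h k where a: "a = h \<otimes> k \<otimes> inv h \<otimes> inv k" "h \<in> carrier G" "k \<in> carrier G"
        and k: "k \<in> lower_central_series G (Suc (Suc n))" using sub by blast
      obtain i where i: "\<chi> k = (1, 2 ^ Suc n * i)" using Suc.IH[OF k] by blast
      obtain e j where ej: "\<chi> h = (e, j)" by (metis surj_pair)
      have "(e, j) \<in> carrier int_affine" using a ej hom_in_carrier[OF \<chi>] by metis
      then have "2 ^ Suc (Suc n) dvd (1 - 1) * j - (1 - e) * (2 ^ Suc n * i)" by auto
      then obtain i' where i': "(1 - 1) * j - (1 - e) * (2 ^ Suc n * i) = 2 ^ Suc (Suc n) * i'" by (rule dvdE)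
      then show "\<exists>i. \<chi> a = (1, 2 ^ Suc (Suc n) * i)"
        unfolding a(1) commutator[OF a(2,3) ej i] i' by blast
    qed (use sub in auto)
  }
qed

text \<open>The image of \<open>xy\<close> is the translation by \<open>-1\<close>, so a suitable power of \<open>xy\<close> lies in any given term of the
series, but not in the next one.\<close>

lemma lower_central_series_not_stabilizing:
  assumes \<chi>: "\<chi> \<in> hom G int_affine" and x: "x \<in> carrier G" "x \<otimes> x = \<one>" "\<chi> x = (- 1, 0)"
    and y: "y \<in> carrier G" "y \<otimes> y = \<one>" "\<chi> y = (- 1, 1)"
  shows "\<not> lower_central_series_stabilizes G"
proof
  assume "lower_central_series_stabilizes G"
  then obtain n where n: "n \<ge> 1" "lower_central_series G (n + 1) = lower_central_series G n"
    unfolding lower_central_series_stabilizes_def by blast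
  then obtain k where k: "n = Suc k" by (cases n) auto
  have hom: "group_hom G int_affine \<chi>"
    using \<chi> group_int_affine by (simp add: group_hom_def group_hom_axioms_def)
  have "\<chi> ((x \<otimes> y) [^] l) = (1, - int l)" for l :: nat
  proof (induction l)
    case 0
    show ?case using group_hom.hom_one[OF hom] by simp
  next
    case (Suc l)
    have "\<chi> ((x \<otimes> y) [^] Suc l) = (1, - int l) \<otimes>\<^bsub>int_affine\<^esub> \<chi> (x \<otimes> y)"
      using hom_mult[OF \<chi>, of "(x \<otimes> y) [^] l" "x \<otimes> y"] x y Suc by simp
    also have "\<chi> (x \<otimes> y) = (1, - 1)" using hom_mult[OF \<chi> x(1) y(1)] x y by simp
    finally show ?case by simp
  qed
  moreover have "(x \<otimes> y) [^] (2 ^ k :: nat) \<in> lower_central_series G (Suc (Suc k))"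
    using lower_central_series_powers[OF x(1,2) y(1,2), of k] n(2) k by simp
  ultimately obtain i where "- int (2 ^ k) = 2 ^ Suc k * i"
    using lower_central_series_translations[OF \<chi>] by (metis prod.inject)
  then have "(2::int) ^ k * (2 * i + 1) = 0" by (simp add: algebra_simps)
  then have "2 * i + 1 = 0" by simp
  then show False by presburger
qed

end

section \<open>The free product of two groups of order two\<close>

lemma semidirect_product_of_retraction:
  assumes G: "group G" and D: "group D" and \<phi>: "\<phi> \<in> hom G D" and \<psi>: "\<psi> \<in> hom D G"
    and retract: "\<And>d. d \<in> carrier D \<Longrightarrow> \<phi> (\<psi> d) = d"
  shows "G\<lparr>carrier := \<psi> ` carrier D\<rparr> \<cong> D"
    and "internal_semidirect_product G (kernel G D \<phi>) (\<psi> ` carrier D)"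
proof -
  interpret G: group G by fact
  interpret \<phi>: group_hom G D \<phi> using G D \<phi> by (simp add: group_hom_def group_hom_axioms_def)
  interpret \<psi>: group_hom D G \<psi> using G D \<psi> by (simp add: group_hom_def group_hom_axioms_def)
  have "\<phi> \<in> iso (G\<lparr>carrier := \<psi> ` carrier D\<rparr>) D"
  proof (rule isoI)
    show "\<phi> \<in> hom (G\<lparr>carrier := \<psi> ` carrier D\<rparr>) D"
      by (rule homI) (auto simp: retract)
    show "bij_betw \<phi> (carrier (G\<lparr>carrier := \<psi> ` carrier D\<rparr>)) (carrier D)"
      by (rule bij_betwI[where g = \<psi>]) (auto simp: retract)
  qed
  then show "G\<lparr>carrier := \<psi> ` carrier D\<rparr> \<cong> D" by (rule is_isoI)
  have sub: "subgroup (\<psi> ` carrier D) G" by (rule \<psi>.img_is_subgroup)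
  have "kernel G D \<phi> <#>\<^bsub>G\<^esub> \<psi> ` carrier D = carrier G"
  proof
    show "kernel G D \<phi> <#>\<^bsub>G\<^esub> \<psi> ` carrier D \<subseteq> carrier G"
      by (auto simp: set_mult_def kernel_def)
    show "carrier G \<subseteq> kernel G D \<phi> <#>\<^bsub>G\<^esub> \<psi> ` carrier D"
    proof
      fix x assume x: "x \<in> carrier G"
      let ?y = "\<psi> (\<phi> x)"
      have y: "?y \<in> carrier G" "\<phi> ?y = \<phi> x" using x retract by auto
      have "x \<otimes>\<^bsub>G\<^esub> inv\<^bsub>G\<^esub> ?y \<in> kernel G D \<phi>" using x y by (simp add: kernel_def)
      moreover have "(x \<otimes>\<^bsub>G\<^esub> inv\<^bsub>G\<^esub> ?y) \<otimes>\<^bsub>G\<^esub> ?y = x" using x y(1) by (simp add: G.m_assoc)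
      ultimately show "x \<in> kernel G D \<phi> <#>\<^bsub>G\<^esub> \<psi> ` carrier D"
        unfolding set_mult_def using imageI[OF \<phi>.hom_closed[OF x], of \<psi>]
        by (intro UN_I[of "x \<otimes>\<^bsub>G\<^esub> inv\<^bsub>G\<^esub> ?y"] UN_I[of ?y]) simp_all
    qed
  qed
  moreover have "kernel G D \<phi> \<inter> \<psi> ` carrier D = {\<one>\<^bsub>G\<^esub>}"
  proof
    show "kernel G D \<phi> \<inter> \<psi> ` carrier D \<subseteq> {\<one>\<^bsub>G\<^esub>}"
      using retract by (auto simp: kernel_def)
    show "{\<one>\<^bsub>G\<^esub>} \<subseteq> kernel G D \<phi> \<inter> \<psi> ` carrier D"
      using subgroup.one_closed[OF sub] by (simp add: kernel_def)
  qed
  ultimately show "internal_semidirect_product G (kernel G D \<phi>) (\<psi> ` carrier D)"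
    using \<phi>.normal_kernel sub by (simp add: internal_semidirect_product_def)
qed

abbreviation (input) "free_involutions \<equiv> free_product (integer_mod_group 2) (integer_mod_group 2)"

text \<open>The defining relations of the free product of two groups of order two, named so that the lemmas on
presented groups apply. The generators include the two neutral elements.\<close>

definition involution_relations :: "((int + int) gword \<times> (int + int) gword) set" where
  "involution_relations =
    {(pos_word [Inl x, Inl y], pos_word [Inl (x \<otimes>\<^bsub>integer_mod_group 2\<^esub> y)]) | x y.
      x \<in> carrier (integer_mod_group 2) \<and> y \<in> carrier (integer_mod_group 2)} \<union>
    {(pos_word [Inr x, Inr y], pos_word [Inr (x \<otimes>\<^bsub>integer_mod_group 2\<^esub> y)]) | x y.
      x \<in> carrier (integer_mod_group 2) \<and> y \<in> carrier (integer_mod_group 2)}"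

lemma carrier_mod_2: "carrier (integer_mod_group 2) = {0, 1}"
  by (auto simp: carrier_integer_mod_group)

lemma free_involutions_eq:
  "free_involutions = presented_group ({0, 1} <+> {0, 1}) involution_relations"
  by (simp add: free_product_def involution_relations_def carrier_mod_2)

abbreviation free_gen :: "int + int \<Rightarrow> (int + int) gword set" where
  "free_gen \<equiv> pres_gen ({0, 1} <+> {0, 1}) involution_relations"

lemma group_free_involutions: "group free_involutions"
  unfolding free_involutions_eq by (rule group_presented_group)

lemma free_gen_closed:
  "x \<in> {0, 1} \<Longrightarrow> free_gen (Inl x) \<in> carrier free_involutions"
  "x \<in> {0, 1} \<Longrightarrow> free_gen (Inr x) \<in> carrier free_involutions"
  unfolding free_involutions_eq by (auto intro: pres_gen_closed)

lemma free_gen_mult: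
  assumes "x \<in> {0, 1}" "y \<in> {0, 1}"
  shows "free_gen (Inl x) \<otimes>\<^bsub>free_involutions\<^esub> free_gen (Inl y) = free_gen (Inl ((x + y) mod 2))"
    "free_gen (Inr x) \<otimes>\<^bsub>free_involutions\<^esub> free_gen (Inr y) = free_gen (Inr ((x + y) mod 2))"
proof -
  interpret group free_involutions by (rule group_free_involutions)
  define z where "z = (x + y) mod 2"
  have z: "z \<in> {0, 1}" unfolding z_def by auto
  have rel: "(pos_word [Inl x, Inl y], pos_word [Inl z]) \<in> involution_relations"
    "(pos_word [Inr x, Inr y], pos_word [Inr z]) \<in> involution_relations"
    using assms unfolding involution_relations_def carrier_mod_2 z_def by auto
  have "gen_prod free_involutions free_gen [Inl x, Inl y] = gen_prod free_involutions free_gen [Inl z]"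
    unfolding free_involutions_eq by (rule gen_prod_pres_gen_eq[OF rel(1)]) (use assms z in auto)
  then show "free_gen (Inl x) \<otimes>\<^bsub>free_involutions\<^esub> free_gen (Inl y) = free_gen (Inl ((x + y) mod 2))"
    using free_gen_closed(1)[OF assms(1)] free_gen_closed(1)[OF assms(2)] free_gen_closed(1)[OF z]
    by (simp flip: z_def)
  have "gen_prod free_involutions free_gen [Inr x, Inr y] = gen_prod free_involutions free_gen [Inr z]"
    unfolding free_involutions_eq by (rule gen_prod_pres_gen_eq[OF rel(2)]) (use assms z in auto)
  then show "free_gen (Inr x) \<otimes>\<^bsub>free_involutions\<^esub> free_gen (Inr y) = free_gen (Inr ((x + y) mod 2))"
    using free_gen_closed(2)[OF assms(1)] free_gen_closed(2)[OF assms(2)] free_gen_closed(2)[OF z]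
    by (simp flip: z_def)
qed

lemma free_gen_0: "free_gen (Inl 0) = \<one>\<^bsub>free_involutions\<^esub>" "free_gen (Inr 0) = \<one>\<^bsub>free_involutions\<^esub>"
proof -
  interpret group free_involutions by (rule group_free_involutions)
  show "free_gen (Inl 0) = \<one>\<^bsub>free_involutions\<^esub>"
    using free_gen_mult(1)[of 0 0] free_gen_closed(1)[of 0] by (simp add: r_cancel_one)
  show "free_gen (Inr 0) = \<one>\<^bsub>free_involutions\<^esub>"
    using free_gen_mult(2)[of 0 0] free_gen_closed(2)[of 0] by (simp add: r_cancel_one)
qed

lemma free_gen_involution:
  "free_gen (Inl 1) \<otimes>\<^bsub>free_involutions\<^esub> free_gen (Inl 1) = \<one>\<^bsub>free_involutions\<^esub>"
  "free_gen (Inr 1) \<otimes>\<^bsub>free_involutions\<^esub> free_gen (Inr 1) = \<one>\<^bsub>free_involutions\<^esub>"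
  using free_gen_mult[of 1 1] free_gen_0 by auto

lemma free_involutions_generate:
  "carrier free_involutions = generate free_involutions {free_gen (Inl 1), free_gen (Inr 1)}"
proof
  interpret group free_involutions by (rule group_free_involutions)
  let ?H = "generate free_involutions {free_gen (Inl 1), free_gen (Inr 1)}"
  have car: "{free_gen (Inl 1), free_gen (Inr 1)} \<subseteq> carrier free_involutions"
    using free_gen_closed by auto
  show "?H \<subseteq> carrier free_involutions" using car by (rule generate_incl)
  have "free_gen ` ({0, 1} <+> {0, 1}) \<subseteq> ?H"
    using free_gen_0 by (auto intro: generate.incl generate.one)
  then have "generate free_involutions (free_gen ` ({0, 1} <+> {0, 1})) \<subseteq> ?H"
    using generate_is_subgroup[OF car] by (rule generate_subgroup_incl)
  then show "carrier free_involutions \<subseteq> ?H"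
    using presented_group_generate[of "{0, 1} <+> {0, 1}" involution_relations]
    by (simp flip: free_involutions_eq)
qed

lemma (in group) free_involutions_hom_exists:
  assumes a: "a \<in> carrier G" "a \<otimes> a = \<one>" and b: "b \<in> carrier G" "b \<otimes> b = \<one>"
  obtains h where "h \<in> hom free_involutions G" "h (free_gen (Inl 1)) = a" "h (free_gen (Inr 1)) = b"
proof -
  define f :: "int + int \<Rightarrow> 'a" where
    "f = case_sum (\<lambda>i. if i = 0 then \<one> else a) (\<lambda>i. if i = 0 then \<one> else b)"
  have f: "f \<in> {0, 1} <+> {0, 1} \<rightarrow> carrier G" using a b by (auto simp: f_def)
  have R: "word_val G f u = word_val G f v" if "(u, v) \<in> involution_relations" for u v
    using that a b unfolding involution_relations_def carrier_mod_2
    by (auto simp: word_val_pos_word f_def)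
  obtain h where h: "h \<in> hom free_involutions G" "\<And>x. x \<in> {0, 1} <+> {0, 1} \<Longrightarrow> h (free_gen x) = f x"
    using presented_group_hom_exists[OF f R] unfolding free_involutions_eq by blast
  show ?thesis
    by (rule that[OF h(1)]) (use h(2)[of "Inl 1"] h(2)[of "Inr 1"] in \<open>auto simp: f_def\<close>)
qed

section \<open>Quotients and semidirect decompositions of the cactus group\<close>

context coxeter_system
begin

abbreviation C where "C \<equiv> cactus_group S m"
abbreviation c where "c \<equiv> cactus_gen S m"

lemma group_cactus: "group C"
  unfolding cactus_group_def by (rule group_presented_group)

lemma cactus_gen_closed: "X \<in> fin_irr S m \<Longrightarrow> c X \<in> carrier C"
  unfolding cactus_group_def cactus_gen_def by (rule pres_gen_closed)

lemma cactus_relation: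
  "(pos_word u, pos_word v) \<in> cactus_relations S m \<Longrightarrow> u \<in> lists (fin_irr S m) \<Longrightarrow>
    v \<in> lists (fin_irr S m) \<Longrightarrow> gen_prod C c u = gen_prod C c v"
  unfolding cactus_group_def cactus_gen_def by (rule gen_prod_pres_gen_eq)

lemma cactus_gen_square:
  assumes X: "X \<in> fin_irr S m"
  shows "c X \<otimes>\<^bsub>C\<^esub> c X = \<one>\<^bsub>C\<^esub>"
proof -
  interpret C: group C by (rule group_cactus)
  have "(pos_word [X, X], pos_word []) \<in> cactus_relations S m"
    using X by (auto simp: cactus_relations_def pos_word_def)
  from cactus_relation[OF this] show ?thesis using X cactus_gen_closed[OF X] by simp
qed

text \<open>A relation \<open>c\<^sub>V c\<^sub>T = c\<^sub>\<omega> c\<^sub>V\<close> is checked for the possibilities in the definition of the labelling, and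
a commutation relation can only fail for two different sets among \<open>X\<close>, \<open>Y\<close>, \<open>Z\<close>, which have an
irreducible union.\<close>

lemma cactus_hom_of_labelling:
  fixes H (structure)
  assumes L: "dihedral_labelling X Y Z" and H: "group H"
    and p: "p \<in> carrier H" "p \<otimes> p = \<one>" and q: "q \<in> carrier H" "q \<otimes> q = \<one>"
  obtains h where "h \<in> hom C H" "h (c X) = p" "h (c Y) = q"
proof -
  interpret H: group H by fact
  define f where "f T = (if T = X then p else if T = Y then q else if T = Z then p \<otimes> q \<otimes> p else \<one>)" for T
  have f_closed: "f T \<in> carrier H" for T using p q by (simp add: f_def)
  have aba: "(p \<otimes> q \<otimes> p) \<otimes> (p \<otimes> q \<otimes> p) = \<one>"
  proof -
    have "(p \<otimes> q \<otimes> p) \<otimes> (p \<otimes> q \<otimes> p) = p \<otimes> (q \<otimes> ((p \<otimes> p) \<otimes> q)) \<otimes> p"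
      using p(1) q(1) by (simp only: H.m_assoc H.m_closed)
    then show ?thesis using p q by simp
  qed
  have L': "X \<in> fin_irr S m" "Y \<in> fin_irr S m" "X \<noteq> Y"
    "\<And>V V'. V \<in> {X, Y, Z} \<Longrightarrow> V' \<in> {X, Y, Z} \<Longrightarrow> V \<noteq> V' \<Longrightarrow> cox_irreducible m (V \<union> V')"
    using L unfolding dihedral_labelling_def by blast+
  have R: "word_val H f u = word_val H f v" if "(u, v) \<in> cactus_relations S m" for u v
  proof -
    have "(\<exists>V\<in>fin_irr S m. (u, v) = (pos_word [V, V], [])) \<or>
      (\<exists>V\<in>fin_irr S m. \<exists>T\<in>fin_irr S m. T \<subset> V \<and>
        (u, v) = (pos_word [V, T], pos_word [omega_conj S m V T, V])) \<or>
      (\<exists>V T. \<not> cox_irreducible m (T \<union> V) \<and> (u, v) = (pos_word [T, V], pos_word [V, T]))"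
      using that unfolding cactus_relations_def Omega0_def Omega1_def by blast
    then consider (sq) V where "u = pos_word [V, V]" "v = pos_word []"
      | (omega) V T where "V \<in> fin_irr S m" "T \<in> fin_irr S m" "T \<subset> V"
          "u = pos_word [V, T]" "v = pos_word [omega_conj S m V T, V]"
      | (com) V T where "\<not> cox_irreducible m (T \<union> V)" "u = pos_word [T, V]" "v = pos_word [V, T]"
      by (auto simp: pos_word_def)
    then show ?thesis
    proof cases
      case sq
      have "f V \<otimes> f V = \<one>" using p q aba by (simp add: f_def)
      then show ?thesis unfolding sq word_val_pos_word using f_closed by simp
    next
      case omega
      have "T \<notin> {X, Y, Z} \<and> omega_conj S m V T \<notin> {X, Y, Z} \<or>
        V \<notin> {X, Y, Z} \<and> omega_conj S m V T = T \<or>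
        V = X \<and> X \<noteq> Z \<and> Y \<noteq> Z \<and> T = Y \<and> omega_conj S m V T = Z \<or>
        V = X \<and> X \<noteq> Z \<and> Y \<noteq> Z \<and> T = Z \<and> omega_conj S m V T = Y"
        using L[unfolded dihedral_labelling_def, THEN conjunct2, THEN conjunct2, THEN conjunct2,
            THEN conjunct2, THEN bspec, OF omega(1), THEN bspec, OF omega(2), THEN mp, OF omega(3)] .
      then have "f V \<otimes> f T = f (omega_conj S m V T) \<otimes> f V"
      proof (elim disjE conjE)
        assume "T \<notin> {X, Y, Z}" "omega_conj S m V T \<notin> {X, Y, Z}"
        then show ?thesis using f_closed[of V] by (simp add: f_def[of T] f_def[of "omega_conj S m V T"])
      next
        assume "V \<notin> {X, Y, Z}" "omega_conj S m V T = T"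
        then show ?thesis using f_closed[of T] by (simp add: f_def[of V])
      next
        assume "V = X" "X \<noteq> Z" "Y \<noteq> Z" "T = Y" "omega_conj S m V T = Z"
        then show ?thesis using L'(3) p q by (simp add: f_def H.m_assoc)
      next
        assume *: "V = X" "X \<noteq> Z" "Y \<noteq> Z" "T = Z" "omega_conj S m V T = Y"
        have "p \<otimes> (p \<otimes> q \<otimes> p) = (p \<otimes> p) \<otimes> q \<otimes> p"
          using p(1) q(1) by (simp only: H.m_assoc H.m_closed)
        then show ?thesis using * L'(3) p q by (simp add: f_def)
      qed
      then show ?thesis unfolding omega word_val_pos_word using f_closed by simp
    next
      case com
      have "T = V \<or> T \<notin> {X, Y, Z} \<or> V \<notin> {X, Y, Z}" using com(1) L'(4) by blast
      then have "f T \<otimes> f V = f V \<otimes> f T"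
      proof (elim disjE)
        assume "T \<notin> {X, Y, Z}"
        then show ?thesis using f_closed[of V] by (simp add: f_def[of T])
      next
        assume "V \<notin> {X, Y, Z}"
        then show ?thesis using f_closed[of T] by (simp add: f_def[of V])
      qed simp
      then show ?thesis unfolding com word_val_pos_word using f_closed by simp
    qed
  qed
  have "f \<in> fin_irr S m \<rightarrow> carrier H" using f_closed by simp
  from H.presented_group_hom_exists[OF this R]
  obtain h where h: "h \<in> hom C H" "\<And>T. T \<in> fin_irr S m \<Longrightarrow> h (c T) = f T"
    unfolding cactus_group_def cactus_gen_def by blast
  show ?thesis
  proof (rule that[OF h(1)])
    show "h (c X) = p" "h (c Y) = q" using h(2) L'(1-3) by (auto simp: f_def)
  qed
qed

text \<open>The labelling gives a homomorphism onto the free product. The relations \<open>c\<^sub>X\<^sup>2 = c\<^sub>Y\<^sup>2 = 1\<close> give a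
homomorphism in the other direction, which is a section of the first one.\<close>

lemma cactus_free_involutions_factor:
  assumes L: "dihedral_labelling X Y Z"
  obtains G where "subgroup G C" "C\<lparr>carrier := cactus_sub S m {X, Y}\<rparr> \<cong> free_involutions"
    "internal_semidirect_product C G (cactus_sub S m {X, Y})"
proof -
  let ?D = "free_involutions" and ?a = "free_gen (Inl 1)" and ?b = "free_gen (Inr 1)"
  interpret C: group C by (rule group_cactus)
  interpret D: group ?D by (rule group_free_involutions)
  have XY: "X \<in> fin_irr S m" "Y \<in> fin_irr S m" using L by (auto simp: dihedral_labelling_def)
  have ab: "?a \<in> carrier ?D" "?b \<in> carrier ?D" using free_gen_closed by auto
  obtain \<phi> where \<phi>: "\<phi> \<in> hom C ?D" "\<phi> (c X) = ?a" "\<phi> (c Y) = ?b"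
    using cactus_hom_of_labelling[OF L D.group_axioms ab(1) free_gen_involution(1) ab(2) free_gen_involution(2)] .
  obtain \<psi> where \<psi>: "\<psi> \<in> hom ?D C" "\<psi> ?a = c X" "\<psi> ?b = c Y"
    using C.free_involutions_hom_exists[OF cactus_gen_closed[OF XY(1)] cactus_gen_square[OF XY(1)]
        cactus_gen_closed[OF XY(2)] cactus_gen_square[OF XY(2)]] .
  interpret \<phi>: group_hom C ?D \<phi> by unfold_locales (rule \<phi>(1))
  interpret \<psi>: group_hom ?D C \<psi> by unfold_locales (rule \<psi>(1))
  have retract: "\<phi> (\<psi> d) = d" if "d \<in> carrier ?D" for d
  proof -
    have "(\<phi> \<circ> \<psi>) d = id d"
    proof (rule hom_eq_on_generate[OF D.group_axioms D.group_axioms,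
          where h = "\<phi> \<circ> \<psi>" and k = id and A = "{?a, ?b}"])
      show "\<phi> \<circ> \<psi> \<in> hom ?D ?D" using \<psi>(1) \<phi>(1) by (rule hom_compose)
      show "id \<in> hom ?D ?D" by (auto simp: hom_def)
      show "{?a, ?b} \<subseteq> carrier ?D" using ab by simp
      show "d \<in> generate ?D {?a, ?b}" using that free_involutions_generate by simp
    qed (use \<phi> \<psi> in auto)
    then show ?thesis by simp
  qed
  have "\<psi> ` carrier ?D = generate C (\<psi> ` {?a, ?b})"
    unfolding free_involutions_generate using ab by (intro \<psi>.generate_img[symmetric]) simp
  then have img: "\<psi> ` carrier ?D = cactus_sub S m {X, Y}" using \<psi> by (simp add: cactus_sub_def)
  note product = semidirect_product_of_retraction[OF C.group_axioms D.group_axioms \<phi>(1) \<psi>(1) retract]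
  show ?thesis
  proof (rule that)
    show "subgroup (kernel C ?D \<phi>) C" by (rule \<phi>.subgroup_kernel)
  qed (use product img in auto)
qed

lemma cactus_lower_central_series:
  assumes L: "dihedral_labelling X Y Z"
  shows "\<not> lower_central_series_stabilizes C" "c X \<otimes>\<^bsub>C\<^esub> c Y \<noteq> c Y \<otimes>\<^bsub>C\<^esub> c X"
proof -
  have XY: "X \<in> fin_irr S m" "Y \<in> fin_irr S m" using L by (auto simp: dihedral_labelling_def)
  obtain \<chi> where \<chi>: "\<chi> \<in> hom C int_affine" "\<chi> (c X) = (- 1, 0)" "\<chi> (c Y) = (- 1, 1)"
    by (rule cactus_hom_of_labelling[OF L group_int_affine, of "(- 1, 0)" "(- 1, 1)"]) auto
  show "\<not> lower_central_series_stabilizes C"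
    using group.lower_central_series_not_stabilizing[OF group_cactus \<chi>(1) _ _ \<chi>(2) _ _ \<chi>(3)]
      cactus_gen_closed cactus_gen_square XY by blast
  have "\<chi> (c X \<otimes>\<^bsub>C\<^esub> c Y) = (1, - 1)" "\<chi> (c Y \<otimes>\<^bsub>C\<^esub> c X) = (1, 1)"
    using \<chi> hom_mult[OF \<chi>(1)] cactus_gen_closed XY by auto
  then show "c X \<otimes>\<^bsub>C\<^esub> c Y \<noteq> c Y \<otimes>\<^bsub>C\<^esub> c X" by auto
qed

lemma comm_group_coxeter_iff:
  "comm_group W \<longleftrightarrow> (\<forall>s\<in>S. \<forall>t\<in>S. s \<noteq> t \<longrightarrow> m s t = 2)"
proof
  assume "comm_group W"
  then show "\<forall>s\<in>S. \<forall>t\<in>S. s \<noteq> t \<longrightarrow> m s t = 2"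
    using gens_commute_imp_m_eq_2 gen_closed by (metis comm_groupE(4))
next
  assume m2: "\<forall>s\<in>S. \<forall>t\<in>S. s \<noteq> t \<longrightarrow> m s t = 2"
  show "comm_group W"
  proof (rule comm_group_if_gens_commute[of W "g ` S"])
    show "g ` S \<subseteq> carrier W" using gen_closed by blast
    show "carrier W = generate W (g ` S)" using carrier_W_eq_parabolic by (simp add: parabolic_def)
    fix x y assume "x \<in> g ` S" "y \<in> g ` S"
    then obtain s t where st: "s \<in> S" "t \<in> S" "x = g s" "y = g t" by blast
    show "x \<otimes>\<^bsub>W\<^esub> y = y \<otimes>\<^bsub>W\<^esub> x"
    proof (cases "s = t")
      case False
      then have "m s t = enat 2" using m2 st by (simp add: numeral_eq_enat)
      from ev_altw[OF st(1,2) False this] show ?thesis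
        using st gen_closed by (simp add: numeral_2_eq_2)
    qed (use st in simp)
  qed (rule W.group_axioms)
qed

lemma comm_group_cactus_if:
  assumes m2: "\<And>s t. s \<in> S \<Longrightarrow> t \<in> S \<Longrightarrow> s \<noteq> t \<Longrightarrow> m s t = 2"
  shows "comm_group C"
proof (rule comm_group_if_gens_commute[of C "c ` fin_irr S m"])
  interpret C: group C by (rule group_cactus)
  show "c ` fin_irr S m \<subseteq> carrier C" using cactus_gen_closed by blast
  show "carrier C = generate C (c ` fin_irr S m)"
    unfolding cactus_group_def cactus_gen_def by (rule presented_group_generate)
  fix x y assume "x \<in> c ` fin_irr S m" "y \<in> c ` fin_irr S m"
  then obtain X Y where XY: "X \<in> fin_irr S m" "Y \<in> fin_irr S m" "x = c X" "y = c Y" by blast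
  have sub: "X \<subseteq> S" "Y \<subseteq> S" using fin_irr_D(1) XY by auto
  have single: "\<exists>s. V = {s}" if V: "V \<in> fin_irr S m" for V
  proof -
    obtain s where s: "s \<in> V" using fin_irr_D(2)[OF V] by blast
    have "V \<subseteq> {s} \<or> V \<subseteq> V - {s}"
      using fin_irr_D(1)[OF V] s m2
      by (intro cox_irreducible_split[OF fin_irr_D(4)[OF V]]) auto
    then show ?thesis using s by blast
  qed
  obtain s t where st: "X = {s}" "Y = {t}" using single XY by blast
  show "x \<otimes>\<^bsub>C\<^esub> y = y \<otimes>\<^bsub>C\<^esub> x"
  proof (cases "s = t")
    case False
    have "\<not> cox_irreducible m (X \<union> Y)"
      using cox_irreducible_split[of m "X \<union> Y" X Y] m2 st sub False by auto
    then have "(pos_word [X, Y], pos_word [Y, X]) \<in> cactus_relations S m"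
      using XY by (auto simp: cactus_relations_def Omega1_def)
    from cactus_relation[OF this] show ?thesis using XY cactus_gen_closed by simp
  qed (use XY st in simp)
qed (rule group_cactus)

end

theorem theorem0p3:
  fixes S :: "'s set" and m :: "'s \<Rightarrow> 's \<Rightarrow> enat"
  assumes "coxeter_matrix S m"
  shows "(comm_group (cactus_group S m) \<longleftrightarrow> comm_group (coxeter_group S m)) \<and>
    (\<not> comm_group (coxeter_group S m) \<longrightarrow>
      (\<exists>X Y G. X \<in> fin_irr S m \<and> Y \<in> fin_irr S m \<and> subgroup G (cactus_group S m) \<and>
        (cactus_group S m)\<lparr>carrier := cactus_sub S m {X, Y}\<rparr>
          \<cong> free_product (integer_mod_group 2) (integer_mod_group 2) \<and>
        internal_semidirect_product (cactus_group S m) G (cactus_sub S m {X, Y}) \<and>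
        \<not> lower_central_series_stabilizes (cactus_group S m)))"
proof -
  interpret coxeter_system S m by unfold_locales (rule assms)
  show ?thesis
  proof (cases "comm_group W")
    case True
    then have "comm_group C" using comm_group_coxeter_iff comm_group_cactus_if by blast
    then show ?thesis using True by simp
  next
    case False
    then obtain s t where "s \<in> S" "t \<in> S" "s \<noteq> t" "m s t \<noteq> 2" using comm_group_coxeter_iff by blast
    from dihedral_labelling_exists[OF this] obtain X Y Z where L: "dihedral_labelling X Y Z" .
    then have XY: "X \<in> fin_irr S m" "Y \<in> fin_irr S m" by (auto simp: dihedral_labelling_def)
    have "\<not> comm_group C"
      using cactus_lower_central_series(2)[OF L] cactus_gen_closed XY by (metis comm_groupE(4))
    moreover obtain G where "subgroup G C" "C\<lparr>carrier := cactus_sub S m {X, Y}\<rparr> \<cong> free_involutions"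
      "internal_semidirect_product C G (cactus_sub S m {X, Y})"
      using cactus_free_involutions_factor[OF L] .
    ultimately show ?thesis using False XY cactus_lower_central_series(1)[OF L] by blast
  qed
qed

end
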